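(* For any graph $G$ and integer $k\geq\mathrm{tw}(G)+1$, $G$ has a tree-decomposition of width at most $72k+1$, degree at most $12$, and order at most $\max\{\frac{|V(G)|}{2k},1\}$, in which each vertex $v\in V(G)$ has spread at most $1+\deg_G(v)$.
   Context: Graphs are simple, undirected and finite. For a non-empty tree $T$, a $T$-decomposition of a graph $G$ is a collection $(B_x:x\in V(T))$ of subsets $B_x\subseteq V(G)$ (bags) such that for each edge $vw\in E(G)$ some bag contains both $v$ and $w$, and for each $v\in V(G)$ the set $\{x\in V(T):v\in B_x\}$ induces a non-empty connected subtree of $T$. A tree-decomposition is a $T$-decomposition for some tree $T$. Its width is $\max_x|B_x|-1$, its degree is the maximum degree of $T$, its order is $|V(T)|$, and the spread of a vertex $v$ is the number of nodes $x$ with $v\in B_x$. $\mathrm{tw}(G)$ is the minimum width of a tree-decomposition of $G$. *)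

theory Defs
  imports "Graph_Theory.Graph_Theory"
begin

text \<open>
  A finite simple undirected graph is a \<open>pair_graph\<close>: a finite vertex set \<open>pverts G\<close> with an
  irreflexive symmetric arc relation \<open>parcs G\<close>, where an edge \<open>vw\<close> is the pair of arcs
  \<open>(v, w)\<close>, \<open>(w, v)\<close>. The null graph is included. The degree of \<open>v\<close> is \<open>out_degree G v\<close>.

  The library's predicate \<open>tree\<close> cannot be used for such graphs, because it regards the walk
  \<open>u, v, u\<close> along a single edge as a cycle. A cycle of an undirected graph is a cycle of the
  symmetric digraph with at least three arcs.
\<close>

definition undirected_tree :: "'a pair_pre_digraph \<Rightarrow> bool" where
  "undirected_tree T \<longleftrightarrow>
     pair_graph T \<and> connected T \<and> \<not> (\<exists>p. pre_digraph.cycle T p \<and> 3 \<le> length p)"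

definition bag_nodes :: "'b pair_pre_digraph \<Rightarrow> ('b \<Rightarrow> 'a set) \<Rightarrow> 'a \<Rightarrow> 'b set" where
  "bag_nodes T B v = {x \<in> pverts T. v \<in> B x}"

text \<open>Both \<open>undirected_tree T\<close> and the last condition below entail non-emptiness, since
  \<open>connected\<close> excludes the null graph.\<close>

definition tree_decomposition ::
  "'a pair_pre_digraph \<Rightarrow> 'b pair_pre_digraph \<Rightarrow> ('b \<Rightarrow> 'a set) \<Rightarrow> bool" where
  "tree_decomposition G T B \<longleftrightarrow>
     undirected_tree T \<and>
     (\<forall>x \<in> pverts T. B x \<subseteq> pverts G) \<and>
     (\<forall>(v, w) \<in> parcs G. \<exists>x \<in> pverts T. v \<in> B x \<and> w \<in> B x) \<and>
     (\<forall>v \<in> pverts G. connected (T \<restriction> bag_nodes T B v))"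

text \<open>Widths are integers, as the null graph has a tree-decomposition of width \<open>-1\<close>.\<close>

definition decomp_width :: "'b pair_pre_digraph \<Rightarrow> ('b \<Rightarrow> 'a set) \<Rightarrow> int" where
  "decomp_width T B = int (Max ((\<lambda>x. card (B x)) ` pverts T)) - 1"

definition decomp_degree :: "'b pair_pre_digraph \<Rightarrow> nat" where
  "decomp_degree T = Max (out_degree T ` pverts T)"

definition decomp_order :: "'b pair_pre_digraph \<Rightarrow> nat" where
  "decomp_order T = card (pverts T)"

definition spread :: "'b pair_pre_digraph \<Rightarrow> ('b \<Rightarrow> 'a set) \<Rightarrow> 'a \<Rightarrow> nat" where
  "spread T B v = card (bag_nodes T B v)"

text \<open>Trees are finite, so letting the nodes be natural numbers covers all trees up to
  isomorphism.\<close>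

definition treewidth :: "'a pair_pre_digraph \<Rightarrow> int" where
  "treewidth G = (LEAST w. \<exists>(T :: nat pair_pre_digraph) B.
     tree_decomposition G T B \<and> decomp_width T B = w)"

end

theory Submission
  imports Defs
begin

text \<open>
  The decomposition is built recursively, for a subgraph together with a set \<open>S\<close> of between \<open>4 * k\<close>
  and \<open>24 * k\<close> vertices that has to lie in the root bag. If \<open>S\<close> has more than \<open>12 * k\<close> elements,
  a separator of size at most \<open>k\<close> that is balanced with respect to \<open>S\<close> splits the graph, and the roots
  of the two resulting decompositions are identified. Otherwise \<open>S\<close> itself is the root bag, and the
  set for the only child consists of the vertices \<open>v\<close> of \<open>S\<close> that have a neighbour outside \<open>S\<close> and
  of \<open>12 * k\<close> vertices outside \<open>S\<close>, among them one such neighbour of each \<open>v\<close>. The edge from \<open>v\<close> to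
  this neighbour is covered by the child bag and can be deleted, so an additional bag containing \<open>v\<close>
  lowers the degree of \<open>v\<close>, which bounds the spread; and every new node is paid for by at least
  \<open>2 * k\<close> new vertices, which bounds the order.
\<close>

section \<open>Balanced separators\<close>

text \<open>Connectivity, expressed by the absence of an edgeless cut.\<close>

definition linked :: "('b \<times> 'b) set \<Rightarrow> 'b set \<Rightarrow> bool" where
  "linked E U \<longleftrightarrow> U \<noteq> {} \<and> (\<forall>W. W \<noteq> {} \<longrightarrow> W \<subset> U \<longrightarrow> (\<exists>a\<in>W. \<exists>b\<in>U - W. (a, b) \<in> E))"

lemma linkedE:
  assumes "linked E U" "W \<noteq> {}" "W \<subset> U"
  obtains a b where "a \<in> W" "b \<in> U - W" "(a, b) \<in> E"
  using assms unfolding linked_def by blast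

section \<open>Connectivity, leaves and the Helly property in trees\<close>

lemma connected_induce_imp_linked:
  assumes "pair_graph T" "N \<subseteq> pverts T" "connected (T \<restriction> N)"
  shows "linked (parcs T) N"
  unfolding linked_def
proof (intro conjI allI impI)
  interpret pair_graph T by fact
  have c: "N \<noteq> {}" "\<And>u v. u \<in> N \<Longrightarrow> v \<in> N \<Longrightarrow> (u, v) \<in> rtrancl_on N ((arcs_ends (T \<restriction> N))\<^sup>s)"
    using assms(3) by (auto simp: connected_conv)
  show "N \<noteq> {}" by (rule c)
  fix W assume W: "W \<noteq> {}" "W \<subset> N"
  then obtain a b where ab: "a \<in> W" "b \<in> N - W" by blast
  show "\<exists>a\<in>W. \<exists>b\<in>N - W. (a, b) \<in> parcs T"
  proof (rule ccontr)
    assume n: "\<not> ?thesis"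
    \<comment> \<open>A walk from \<open>a\<close> to \<open>b\<close> inside \<open>N\<close>
      starts in \<open>W\<close>, and no arc leads from \<open>W\<close> to the rest of
      \<open>N\<close>, so it stays in \<open>W\<close>.\<close>
    have "(a, b) \<in> rtrancl_on N ((arcs_ends (T \<restriction> N))\<^sup>s)" using c ab W by blast
    then have "b \<in> W"
    proof (induction rule: rtrancl_on_induct)
      case base then show ?case using ab by simp
    next
      case (step y z)
      have "(y, z) \<in> parcs T"
        using step(2) by (auto simp: symcl_def arcs_ends_conv intro: arcs_symmetric)
      then show ?case using n step by blast
    qed
    then show False using ab by simp
  qed
qed

lemma connected_imp_linked:
  assumes "pair_graph T" "connected T"
  shows "linked (parcs T) (pverts T)"
proof -
  interpret pair_graph T by fact
  have "T \<restriction> pverts T = with_proj T"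
    by (auto simp: induce_subgraph_def with_proj_def intro: in_arcsD1 in_arcsD2)
  then show ?thesis using connected_induce_imp_linked[OF assms(1) order_refl] assms(2) by simp
qed

text \<open>A cut of \<open>U - {y}\<close> extends to a cut of \<open>U\<close> by putting
  \<open>y\<close> on the side of its only possible neighbour \<open>x\<close>. The edge crossing
  the extended cut then avoids \<open>y\<close>, so it crosses the original one.\<close>

lemma linked_delete_leaf:
  assumes "linked E U" "sym E" "\<And>b. b \<in> U \<Longrightarrow> (y, b) \<in> E \<Longrightarrow> b = x" "U - {y} \<noteq> {}"
  shows "linked E (U - {y})"
  unfolding linked_def
proof (intro conjI allI impI)
  show "U - {y} \<noteq> {}" by fact
  fix W assume W: "W \<noteq> {}" "W \<subset> U - {y}"
  show "\<exists>a\<in>W. \<exists>b\<in>U - {y} - W. (a, b) \<in> E"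
  proof (cases "x \<in> W \<and> y \<in> U")
    case True
    then have "insert y W \<noteq> {}" "insert y W \<subset> U" using W by auto
    with assms(1) obtain a b where "a \<in> insert y W" "b \<in> U - insert y W" "(a, b) \<in> E"
      by (rule linkedE)
    with assms(3) True show ?thesis by blast
  next
    case False
    have "W \<subset> U" using W by auto
    with assms(1) W(1) obtain a b where ab: "a \<in> W" "b \<in> U - W" "(a, b) \<in> E"
      by (rule linkedE)
    then have "b \<noteq> y" using assms(3)[of a] False W symD[OF assms(2)] by blast
    then show ?thesis using ab by blast
  qed
qed

text \<open>Translates a path given as a list of vertices into the arc list on which the notions of
  walk and cycle are based.\<close>

lemma walk_of_vertices:
  "pcas v (zip (v # vs) vs) (last (v # vs)) \<and> pawalk_verts v (zip (v # vs) vs) = v # vs \<and>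
   (successively (\<lambda>a b. (a, b) \<in> E) (v # vs) \<longrightarrow> set (zip (v # vs) vs) \<subseteq> E)"
  by (induction vs arbitrary: v) auto

text \<open>All neighbours in \<open>N\<close> of the first vertex of a longest path in
  \<open>N\<close> lie on that path. If every vertex had two neighbours in \<open>N\<close>, one of
  them other than the second path vertex would close a cycle. The form with a single candidate
  \<open>x\<close> for the neighbours also covers a vertex that has none.\<close>

lemma undirected_tree_leaf:
  assumes "undirected_tree T" "N \<noteq> {}" "N \<subseteq> pverts T"
  shows "\<exists>y\<in>N. \<exists>x. \<forall>b\<in>N. (y, b) \<in> parcs T \<longrightarrow> b = x"
proof (rule ccontr)
  assume "\<not> ?thesis"
  then have two: "\<And>y x. y \<in> N \<Longrightarrow> \<exists>b\<in>N. (y, b) \<in> parcs T \<and> b \<noteq> x" by blast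
  have "pair_graph T" using assms(1) by (simp add: undirected_tree_def)
  then interpret pair_graph T .
  have fin: "finite N" using assms(3) pair_finite_verts finite_subset by blast
  define P where "P xs \<longleftrightarrow> xs \<noteq> [] \<and> distinct xs \<and> set xs \<subseteq> N \<and>
    successively (\<lambda>a b. (a, b) \<in> parcs T) xs" for xs
  from assms(2) obtain n where "n \<in> N" by blast
  then have "P [n]" by (simp add: P_def)
  moreover have "\<forall>xs. P xs \<longrightarrow> length xs < Suc (card N)"
    using fin by (auto simp: P_def less_Suc_eq_le distinct_card[symmetric] intro: card_mono)
  ultimately obtain xs where xs: "P xs" and mx: "\<And>ys. P ys \<Longrightarrow> length ys \<le> length xs"
    using ex_has_greatest_nat[of P "[n]" length "Suc (card N)"] by blast
  from xs obtain x zs where xzs: "xs = x # zs" by (cases xs) (auto simp: P_def)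
  have inzs: "b \<in> set zs" if "b \<in> N" "(x, b) \<in> parcs T" for b
  proof (rule ccontr)
    assume "b \<notin> set zs"
    moreover have "b \<noteq> x" using no_loops'[OF that(2)] by simp
    moreover have "(b, x) \<in> parcs T" using that(2) by (rule arcs_symmetric)
    ultimately have "P (b # xs)" using xs that by (auto simp: P_def xzs)
    then show False using mx by fastforce
  qed
  have "x \<in> N" using xs by (auto simp: P_def xzs)
  obtain c ds where zs: "zs = c # ds"
    using inzs two[OF \<open>x \<in> N\<close>] by (cases zs) auto
  obtain b where b: "b \<in> N" "(x, b) \<in> parcs T" "b \<noteq> c" using two[OF \<open>x \<in> N\<close>] by blast
  then have "b \<in> set ds" using inzs zs by auto
  then obtain ps qs where ds: "ds = ps @ b # qs" by (auto simp: in_set_conv_decomp)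
  \<comment> \<open>The cycle follows the path from \<open>x\<close> via \<open>c\<close> to
    \<open>b\<close> and returns to \<open>x\<close>. Since \<open>b\<close> differs from
    \<open>c\<close>, it has at least three arcs.\<close>
  define vs where "vs = c # ps @ [b, x]"
  have "successively (\<lambda>a b. (a, b) \<in> parcs T) (x # vs)"
    using xs arcs_symmetric[OF b(2)]
    by (auto simp: P_def xzs zs ds vs_def successively_append_iff successively_Cons hd_append
        split: if_splits)
  then have "awalk x (zip (x # vs) vs) x"
    using walk_of_vertices[of x vs "parcs T"] xs
    by (auto simp: awalk_def P_def xzs vs_def intro: subsetD[OF assms(3) \<open>x \<in> N\<close>])
  moreover have "distinct (tl (pawalk_verts x (zip (x # vs) vs)))"
    using walk_of_vertices[of x vs "parcs T"] xs by (auto simp: P_def xzs zs ds vs_def)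
  ultimately have "cycle (zip (x # vs) vs)"
    unfolding cycle_def by (auto simp: vs_def)
  moreover have "3 \<le> length (zip (x # vs) vs)" by (simp add: vs_def)
  ultimately show False using assms(1) by (auto simp: undirected_tree_def)
qed

text \<open>Induction by deleting a leaf \<open>y\<close> of \<open>N\<close>. Unless some
  \<open>F i\<close> is just \<open>{y}\<close>, every \<open>F i\<close> that contains
  \<open>y\<close> also contains the only neighbour \<open>x\<close> of \<open>y\<close>. Hence two
  sets that meet in \<open>y\<close> also meet in \<open>x\<close>, and the sets without
  \<open>y\<close> stay linked and pairwise intersecting. The tree enters only through the existence
  of leaves.\<close>

lemma helly_linked:
  assumes "finite N" "sym E"
    and leaf: "\<And>M. M \<noteq> {} \<Longrightarrow> M \<subseteq> N \<Longrightarrow> \<exists>y\<in>M. \<exists>x. \<forall>b\<in>M. (y, b) \<in> E \<longrightarrow> b = x"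
    and "I \<noteq> {}" "\<And>i. i \<in> I \<Longrightarrow> F i \<subseteq> N" "\<And>i. i \<in> I \<Longrightarrow> linked E (F i)"
    and "\<And>i j. i \<in> I \<Longrightarrow> j \<in> I \<Longrightarrow> F i \<inter> F j \<noteq> {}"
  shows "\<exists>z\<in>N. \<forall>i\<in>I. z \<in> F i"
  using assms(1,3,5-7)
proof (induction N arbitrary: F rule: finite_psubset_induct)
  case (psubset N)
  note leaf = psubset.prems(1) and sub = psubset.prems(2) and link = psubset.prems(3)
    and meet = psubset.prems(4)
  obtain i where "i \<in> I" using \<open>I \<noteq> {}\<close> by blast
  then have "N \<noteq> {}" using sub[of i] meet[of i i] by blast
  from leaf[OF this order_refl]
  obtain y x where yx: "y \<in> N" "\<And>b. b \<in> N \<Longrightarrow> (y, b) \<in> E \<Longrightarrow> b = x" by blast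
  show ?case
  proof (cases "\<exists>i\<in>I. F i = {y}")
    case True
    then obtain i where "i \<in> I" "F i = {y}" by blast
    then have "\<forall>j\<in>I. y \<in> F j" using meet[of i] by fastforce
    then show ?thesis using yx by blast
  next
    case False
    have nonempty: "F i - {y} \<noteq> {}" if "i \<in> I" for i
      using False that meet[OF that that] by blast
    have x_in: "x \<in> F i \<and> x \<noteq> y" if i: "i \<in> I" and "y \<in> F i" for i
    proof -
      have "{y} \<subset> F i" using that nonempty[OF i] by blast
      from link[OF i] insert_not_empty this
      obtain a b where "a \<in> {y}" "b \<in> F i - {y}" "(a, b) \<in> E" by (rule linkedE)
      then show ?thesis using yx(2)[of b] sub[OF i] by blast
    qed
    have "\<exists>z\<in>N - {y}. \<forall>i\<in>I. z \<in> F i - {y}"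
    proof (rule psubset.IH)
      show "N - {y} \<subset> N" using yx by blast
      show "\<exists>y\<in>M. \<exists>x. \<forall>b\<in>M. (y, b) \<in> E \<longrightarrow> b = x" if "M \<noteq> {}" "M \<subseteq> N - {y}" for M
        using leaf[of M] that by (meson Diff_subset order_trans)
      fix i assume i: "i \<in> I"
      show "F i - {y} \<subseteq> N - {y}" using sub[OF i] by blast
      show "linked E (F i - {y})"
        by (rule linked_delete_leaf[OF link[OF i] assms(2) _ nonempty[OF i]])
          (use yx(2) sub[OF i] in blast)
      fix j assume j: "j \<in> I"
      obtain z where "z \<in> F i" "z \<in> F j" using meet[OF i j] by blast
      then show "(F i - {y}) \<inter> (F j - {y}) \<noteq> {}"
        using x_in[OF i] x_in[OF j] by (cases "z = y") blast+
    qed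
    then show ?thesis by blast
  qed
qed

section \<open>Separators that are balanced with respect to a vertex set\<close>

definition balanced :: "('a \<times> 'a) set \<Rightarrow> 'a set \<Rightarrow> 'a set \<Rightarrow> 'a set \<Rightarrow> bool" where
  "balanced E V S X \<longleftrightarrow> (\<forall>U. U \<subseteq> V - X \<longrightarrow> linked E U \<longrightarrow> 2 * card (U \<inter> S) \<le> card S)"

text \<open>If every bag missed a linked set carrying more than half of \<open>S\<close>, those sets would pairwise
  intersect, so the subtrees they trace in the tree would have a node in common by the Helly
  property.\<close>

lemma balanced_bag:
  assumes G: "pair_graph G" and td: "tree_decomposition G T B"
    and S: "S \<subseteq> pverts G" "S \<noteq> {}"
  shows "\<exists>x\<in>pverts T. balanced (parcs G) (pverts G) S (B x)"
proof (rule ccontr)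
  assume "\<not> ?thesis"
  then have "\<forall>x\<in>pverts T. \<exists>U. U \<subseteq> pverts G - B x \<and> linked (parcs G) U \<and>
      card S < 2 * card (U \<inter> S)"
    unfolding balanced_def by (meson not_le)
  then obtain C where C: "\<And>x. x \<in> pverts T \<Longrightarrow> C x \<subseteq> pverts G - B x"
      "\<And>x. x \<in> pverts T \<Longrightarrow> linked (parcs G) (C x)"
      "\<And>x. x \<in> pverts T \<Longrightarrow> card S < 2 * card (C x \<inter> S)"
    by metis
  interpret G: pair_graph G by fact
  have T: "undirected_tree T" and pT: "pair_graph T" "connected T"
    using td by (auto simp: tree_decomposition_def undirected_tree_def)
  interpret T: pair_graph T by fact
  have finS: "finite S" using S G.pair_finite_verts finite_subset by blast
  have symT: "sym (parcs T)" by (auto intro: symI T.arcs_symmetric)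
  define nodes where "nodes v = bag_nodes T B v" for v
  have nodes_iff: "z \<in> nodes v \<longleftrightarrow> z \<in> pverts T \<and> v \<in> B z" for z v
    by (simp add: nodes_def bag_nodes_def)
  have nodes: "linked (parcs T) (nodes v)" if "v \<in> pverts G" for v
    unfolding nodes_def
    by (rule connected_induce_imp_linked[OF pT(1)])
      (use td that in \<open>auto simp: tree_decomposition_def bag_nodes_def\<close>)
  have cover: "\<exists>z. z \<in> nodes a \<and> z \<in> nodes b" if "(a, b) \<in> parcs G" for a b
    using td that by (fastforce simp: tree_decomposition_def nodes_iff)
  define F where "F x = {z \<in> pverts T. B z \<inter> C x \<noteq> {}}" for x
  have F: "linked (parcs T) (F x)" if x: "x \<in> pverts T" for x
    unfolding linked_def
  proof (intro conjI allI impI)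
    have CG: "C x \<subseteq> pverts G" using C(1)[OF x] by blast
    have nF: "nodes v \<subseteq> F x" if "v \<in> C x" for v using that by (auto simp: nodes_iff F_def)
    obtain v where "v \<in> C x" using C(2)[OF x] by (auto simp: linked_def)
    then show "F x \<noteq> {}" using nF nodes CG by (fastforce simp: linked_def)
    fix W assume W: "W \<noteq> {}" "W \<subset> F x"
    show "\<exists>a\<in>W. \<exists>b\<in>F x - W. (a, b) \<in> parcs T"
    proof (rule ccontr)
      assume n: "\<not> ?thesis"
      \<comment> \<open>The nodes of a vertex of \<open>C x\<close> form a linked set inside
        \<open>F x\<close>, so a cut of \<open>F x\<close> without arcs cannot divide them.\<close>
      have side: "nodes v \<subseteq> W" if v: "v \<in> C x" "nodes v \<inter> W \<noteq> {}" for v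
      proof (rule ccontr)
        assume "\<not> nodes v \<subseteq> W"
        then have "nodes v \<inter> W \<subset> nodes v" by blast
        with nodes v(2) obtain a b where "a \<in> nodes v \<inter> W" "b \<in> nodes v - nodes v \<inter> W"
            "(a, b) \<in> parcs T"
          by (metis CG linkedE subsetD v(1))
        then show False using n nF[OF v(1)] by blast
      qed
      \<comment> \<open>The cut \<open>W\<close> of \<open>F x\<close> induces the cut
        \<open>D\<close> of \<open>C x\<close>. An edge of \<open>G\<close> crosses \<open>D\<close>
        because \<open>C x\<close> is linked, and a bag that covers this edge would lie on both
        sides of \<open>W\<close>.\<close>
      define D where "D = {v \<in> C x. nodes v \<inter> W \<noteq> {}}"
      obtain w where "w \<in> W" using W by blast
      then have "w \<in> F x" using W by blast
      then have "D \<noteq> {}" using \<open>w \<in> W\<close> by (fastforce simp: D_def F_def nodes_iff)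
      moreover have "D \<subset> C x"
      proof -
        obtain z where z: "z \<in> F x" "z \<notin> W" using W by blast
        then obtain v where "v \<in> C x" "z \<in> nodes v" by (auto simp: F_def nodes_iff)
        then have "v \<notin> D" using side z by (auto simp: D_def)
        then show ?thesis using \<open>v \<in> C x\<close> by (auto simp: D_def)
      qed
      ultimately obtain a b where ab: "a \<in> D" "b \<in> C x - D" "(a, b) \<in> parcs G"
        using linkedE[OF C(2)[OF x]] by metis
      obtain z where "z \<in> nodes a" "z \<in> nodes b" using cover[OF ab(3)] by blast
      then show False using side[of a] ab by (auto simp: D_def)
    qed
  qed
  have "\<exists>z\<in>pverts T. \<forall>i\<in>pverts T. z \<in> F i"
  proof (rule helly_linked[OF T.pair_finite_verts symT undirected_tree_leaf[OF T]])
    show "pverts T \<noteq> {}" using connected_imp_linked[OF pT] by (simp add: linked_def)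
    fix i assume i: "i \<in> pverts T"
    show "F i \<subseteq> pverts T" by (auto simp: F_def)
    show "linked (parcs T) (F i)" by (rule F[OF i])
    fix j assume j: "j \<in> pverts T"
    have "\<exists>v. v \<in> C i \<and> v \<in> C j"
    proof (rule ccontr)
      assume "\<not> ?thesis"
      then have "card (C i \<inter> S) + card (C j \<inter> S) = card ((C i \<inter> S) \<union> (C j \<inter> S))"
        by (intro card_Un_disjoint[symmetric]) (use finS in auto)
      also have "\<dots> \<le> card S" by (rule card_mono) (use finS in auto)
      finally show False using C(3)[OF i] C(3)[OF j] by linarith
    qed
    then obtain v where v: "v \<in> C i" "v \<in> C j" by blast
    then have "linked (parcs T) (nodes v)" using C(1)[OF i] nodes by blast
    then obtain z where "z \<in> nodes v" by (auto simp: linked_def)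
    then show "F i \<inter> F j \<noteq> {}" using v by (auto simp: F_def nodes_iff)
  qed
  \<comment> \<open>The common node \<open>z\<close> is itself an index: \<open>z \<in> F z\<close>
    says that the bag of \<open>z\<close> meets \<open>C z\<close>, which was chosen to avoid that
    bag.\<close>
  then obtain z where "z \<in> pverts T" "z \<in> F z" by blast
  then show False using C(1)[of z] by (auto simp: F_def)
qed

text \<open>Take \<open>A\<close> smallest among the unions of components of \<open>G - X\<close> that carry at least a third of
  \<open>S - X\<close>.\<close>

lemma balanced_imp_separation:
  assumes "finite V" "sym E" "S \<subseteq> V" "balanced E V S X" "X \<subseteq> V"
    "12 * card X \<le> card S" "0 < card S"
  shows "\<exists>A C. A \<union> C = V - X \<and> A \<inter> C = {} \<and> (\<forall>a\<in>A. \<forall>c\<in>C. (a, c) \<notin> E) \<and>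
    card (S - X) \<le> 3 * card (A \<inter> S) \<and> card (S - X) \<le> 3 * card (C \<inter> S)"
proof -
  define M where "M = card (S - X)"
  have finS: "finite S" using assms(1,3) finite_subset by blast
  have finX: "finite X" using assms(1,5) finite_subset by blast
  have M: "card S \<le> M + card X"
    using diff_card_le_card_Diff[OF finX, of S] by (simp add: M_def)
  have M0: "0 < M" using M assms(6,7) by linarith
  define P where "P A \<longleftrightarrow> A \<subseteq> V - X \<and> (\<forall>a\<in>A. \<forall>b\<in>V - X - A. (a, b) \<notin> E) \<and>
    M \<le> 3 * card (A \<inter> S)" for A
  have "(V - X) \<inter> S = S - X" using assms(3) by blast
  then have "P (V - X)" by (simp add: P_def M_def)
  then obtain A where A: "P A" and mn: "\<And>A'. P A' \<Longrightarrow> card A \<le> card A'"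
    using ex_has_least_nat[of P "V - X" card] by blast
  have finA: "finite A" using A assms(1) finite_subset by (metis P_def finite_Diff)
  have Ane: "A \<noteq> {}" using A M0 by (auto simp: P_def)
  have upper: "3 * card (A \<inter> S) \<le> 2 * M"
  \<comment> \<open>If \<open>A\<close> is linked, it carries at most half of \<open>S\<close>. As
    \<open>X\<close> has at most a twelfth of the size of \<open>S\<close>, this is at most two
    thirds of \<open>M\<close>.\<close>
  proof (cases "linked E A")
    case True
    then have "2 * card (A \<inter> S) \<le> card S" using assms(4) A by (simp add: P_def balanced_def)
    then show ?thesis using M assms(6) by linarith
  next
    case False
    \<comment> \<open>Otherwise \<open>A\<close> splits into \<open>W\<close> and
      \<open>A - W\<close> without edges between them. Both are closed under edges avoiding
      \<open>X\<close> and smaller than \<open>A\<close>, so by minimality each carries less than a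
      third of \<open>M\<close>.\<close>
    then obtain W where W: "W \<noteq> {}" "W \<subset> A" "\<And>a b. a \<in> W \<Longrightarrow> b \<in> A - W \<Longrightarrow> (a, b) \<notin> E"
      using Ane unfolding linked_def by blast
    have small: "3 * card (U \<inter> S) < M"
      if "U \<subset> A" "\<And>a b. a \<in> U \<Longrightarrow> b \<in> A - U \<Longrightarrow> (a, b) \<notin> E" for U
    proof (rule ccontr)
      assume "\<not> ?thesis"
      then have "P U" using that A unfolding P_def by (auto 0 3)
      then show False using mn[of U] psubset_card_mono[OF finA that(1)] by simp
    qed
    have "3 * card (W \<inter> S) < M" using small[of W] W by blast
    moreover have "3 * card ((A - W) \<inter> S) < M"
    proof (rule small)
      show "A - W \<subset> A" using W by blast
      fix a b assume "a \<in> A - W" "b \<in> A - (A - W)"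
      then have "(b, a) \<notin> E" using W by blast
      then show "(a, b) \<notin> E" using symD[OF assms(2)] by blast
    qed
    moreover have "card (A \<inter> S) \<le> card (W \<inter> S) + card ((A - W) \<inter> S)"
    proof -
      have "A \<inter> S = (W \<inter> S) \<union> ((A - W) \<inter> S)" using W by blast
      then show ?thesis using card_Un_le by metis
    qed
    ultimately show ?thesis by linarith
  qed
  have "card (A \<inter> S) + card ((V - X - A) \<inter> S) = M"
  proof -
    have "S - X = (A \<inter> S) \<union> ((V - X - A) \<inter> S)" using A assms(3) by (auto simp: P_def)
    moreover have "card ((A \<inter> S) \<union> ((V - X - A) \<inter> S)) =
        card (A \<inter> S) + card ((V - X - A) \<inter> S)"
      by (rule card_Un_disjoint) (use finS in auto)
    ultimately show ?thesis by (simp add: M_def)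
  qed
  then have "M \<le> 3 * card ((V - X - A) \<inter> S)" using upper by linarith
  then show ?thesis
    using A by (intro exI[of _ A] exI[of _ "V - X - A"]) (auto simp: P_def M_def)
qed

text \<open>The integers are not well-ordered, but every width has the form \<open>int n - 1\<close>
  with a natural number \<open>n\<close>. The minimum is therefore taken over \<open>n\<close> and
  transferred back.\<close>

lemma treewidth_attained:
  fixes T :: "nat pair_pre_digraph"
  assumes "tree_decomposition G T B"
  shows "\<exists>(T :: nat pair_pre_digraph) B. tree_decomposition G T B \<and> decomp_width T B = treewidth G"
proof -
  define Q where "Q w \<longleftrightarrow> (\<exists>(T :: nat pair_pre_digraph) B.
    tree_decomposition G T B \<and> decomp_width T B = w)" for w
  have low: "\<exists>n. w = int n - 1" if "Q w" for w
    using that unfolding Q_def decomp_width_def by blast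
  define m where "m = (LEAST n. Q (int n - 1))"
  have "Q (decomp_width T B)" using assms by (auto simp: Q_def)
  then have "\<exists>n. Q (int n - 1)" using low by metis
  then have m: "Q (int m - 1)" unfolding m_def by (rule LeastI_ex)
  have "(LEAST w. Q w) = int m - 1"
  proof (rule Least_equality)
    show "Q (int m - 1)" by (rule m)
    fix w assume "Q w"
    moreover from low[OF this] obtain n where "w = int n - 1" by blast
    ultimately have "m \<le> n" unfolding m_def by (intro Least_le) simp
    then show "int m - 1 \<le> w" using \<open>w = int n - 1\<close> by simp
  qed
  then have "Q (treewidth G)" using m by (simp add: treewidth_def Q_def)
  then show ?thesis by (simp add: Q_def)
qed

section \<open>Rooted decompositions\<close>

text \<open>Rooted ordered trees with a bag at each node. Identifying two roots amounts to uniting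
  their bags and appending their lists of children.\<close>

datatype 'a bag_tree = Node (root_bag: "'a set") (children: "'a bag_tree list")

fun nodes :: "'a bag_tree \<Rightarrow> nat" where
  "nodes (Node B ts) = Suc (sum_list (map nodes ts))"

fun support :: "'a bag_tree \<Rightarrow> 'a set" where
  "support (Node B ts) = B \<union> (\<Union>t\<in>set ts. support t)"

text \<open>The connectivity condition of a tree-decomposition in local form. Relating list entries
  by \<open>sorted_wrt\<close> rather than members of a set also constrains two equal subtrees at
  different places of the list.\<close>

fun coherent :: "'a bag_tree \<Rightarrow> bool" where
  "coherent (Node B ts) \<longleftrightarrow>
     (\<forall>t\<in>set ts. coherent t \<and> support t \<inter> B \<subseteq> root_bag t) \<and>
     sorted_wrt (\<lambda>s t. support s \<inter> support t \<subseteq> B) ts"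

fun covers :: "'a bag_tree \<Rightarrow> 'a \<Rightarrow> 'a \<Rightarrow> bool" where
  "covers (Node B ts) a b \<longleftrightarrow> a \<in> B \<and> b \<in> B \<or> (\<exists>t\<in>set ts. covers t a b)"

fun occurrences :: "'a \<Rightarrow> 'a bag_tree \<Rightarrow> nat" where
  "occurrences v (Node B ts) = (if v \<in> B then 1 else 0) + sum_list (map (occurrences v) ts)"

fun bounded :: "nat \<Rightarrow> nat \<Rightarrow> 'a bag_tree \<Rightarrow> bool" where
  "bounded w d (Node B ts) \<longleftrightarrow> card B \<le> w \<and> length ts \<le> d \<and> (\<forall>t\<in>set ts. bounded w d t)"

lemma occurrences_eq_0: "v \<notin> support t \<Longrightarrow> occurrences v t = 0"
  by (induction t) auto

text \<open>The bounds on the root bag, on the number of children of the root and on the number of nodes are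
  chosen such that they survive the identification of the roots of two decompositions, where
  \<open>card S1 + card S2 \<le> card S + 2 * k\<close>.\<close>

definition rooted_decomposition ::
  "nat \<Rightarrow> 'a set \<Rightarrow> ('a \<times> 'a) set \<Rightarrow> 'a set \<Rightarrow> 'a set \<Rightarrow> 'a bag_tree list \<Rightarrow> bool" where
  "rooted_decomposition k V E S B ts \<longleftrightarrow>
     S \<subseteq> B \<and> support (Node B ts) = V \<and> coherent (Node B ts) \<and>
     (\<forall>a b. (a, b) \<in> E \<longrightarrow> covers (Node B ts) a b) \<and>
     card B + 6 * k \<le> 3 * card S \<and> 2 * k * (length ts + 1) \<le> card S \<and>
     (\<forall>t\<in>set ts. bounded (72 * k) 11 t) \<and>
     2 * k * nodes (Node B ts) \<le> 2 * k + card (V - S) \<and>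
     (\<forall>v\<in>V. occurrences v (Node B ts) \<le> 1 + card (E `` {v}))"

text \<open>For \<open>card S \<le> 24 * k\<close> the invariant gives a root bag of size at most
  \<open>3 * 24 * k - 6 * k\<close> and at most \<open>24 div 2 - 1 = 11\<close> children.\<close>

lemma rooted_decomposition_bounded:
  assumes "rooted_decomposition k V E S B ts" "card S \<le> 24 * k" "1 \<le> k"
  shows "bounded (72 * k) 11 (Node B ts)"
proof -
  have "2 * k * (length ts + 1) \<le> 2 * k * 12"
    using assms(1,2) unfolding rooted_decomposition_def by linarith
  then have "length ts + 1 \<le> 12" using assms(3) by (simp only: mult_le_cancel1)
  then show ?thesis using assms by (auto simp: rooted_decomposition_def)
qed

section \<open>Gluing and extending rooted decompositions\<close>

text \<open>Edges inside \<open>X\<close> are assigned to \<open>E1\<close> alone, so the degrees in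
  \<open>E1\<close> and \<open>E2\<close> add up to the degree in \<open>E\<close>. A vertex of
  \<open>X\<close> lies in both root bags, which become one node, so its spread is at most
  \<open>(1 + d1) + (1 + d2) - 1 = 1 + d\<close> for these degrees.\<close>

lemma rooted_decomposition_merge:
  assumes fin: "finite V" and E: "E \<subseteq> V \<times> V" and V: "V = V1 \<union> V2" and X: "V1 \<inter> V2 = X"
    and S: "S \<subseteq> V"
    and sep: "\<And>a b. (a, b) \<in> E \<Longrightarrow> a \<in> V1 \<and> b \<in> V1 \<or> a \<in> V2 \<and> b \<in> V2"
    and X_le: "card X \<le> k"
    and E1: "E1 = E \<inter> V1 \<times> V1" and E2: "E2 = E - E1"
    and S1: "S1 = (S \<inter> V1) \<union> X" and S2: "S2 = (S \<inter> V2) \<union> X"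
    and d1: "rooted_decomposition k V1 E1 S1 B1 ts1"
    and d2: "rooted_decomposition k V2 E2 S2 B2 ts2"
  shows "rooted_decomposition k V E S (B1 \<union> B2) (ts1 @ ts2)"
proof -
  have fins: "finite V1" "finite V2" "finite E" "finite S" "finite X"
    using fin V E S X by (auto intro: finite_subset)
  have B: "B1 \<subseteq> V1" "B2 \<subseteq> V2" "X \<subseteq> B1" "X \<subseteq> B2" "S1 \<subseteq> B1" "S2 \<subseteq> B2"
    using d1 d2 S1 S2 by (auto simp: rooted_decomposition_def)
  have card_S: "card S1 + card S2 \<le> card S + 2 * k"
  proof -
    have "S1 \<union> S2 = S \<union> X" "S1 \<inter> S2 = X" using S1 S2 S V X by auto
    then have "card S1 + card S2 = card (S \<union> X) + card X"
      using card_Un_Int[of S1 S2] fins S1 S2 by simp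
    then show ?thesis using card_Un_le[of S X] X_le by linarith
  qed
  have sup: "support t \<subseteq> V1" if "t \<in> set ts1" for t
    using d1 that by (auto simp: rooted_decomposition_def)
  have sup2: "support t \<subseteq> V2" if "t \<in> set ts2" for t
    using d2 that by (auto simp: rooted_decomposition_def)
  have c1: "coherent (Node B1 ts1)" and c2: "coherent (Node B2 ts2)"
    using d1 d2 by (auto simp: rooted_decomposition_def)
  \<comment> \<open>A child from one side meets the root bag of the other side only in
    \<open>X\<close>, which its own root bag contains as well.\<close>
  have kid: "coherent t \<and> support t \<inter> (B1 \<union> B2) \<subseteq> root_bag t" if "t \<in> set (ts1 @ ts2)" for t
  proof -
    show ?thesis
    proof (cases "t \<in> set ts1")
      case True
      then have "support t \<inter> (B1 \<union> B2) \<subseteq> support t \<inter> B1" using sup B X by blast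
      then show ?thesis using c1 True by auto
    next
      case False
      then have t: "t \<in> set ts2" using that by auto
      then have "support t \<inter> (B1 \<union> B2) \<subseteq> support t \<inter> B2" using sup2 B X by blast
      then show ?thesis using c2 t by auto
    qed
  qed
  have "sorted_wrt (\<lambda>s t. support s \<inter> support t \<subseteq> B1 \<union> B2) ts1"
    using c1 by (auto elim!: sorted_wrt_mono_rel[rotated])
  moreover have "sorted_wrt (\<lambda>s t. support s \<inter> support t \<subseteq> B1 \<union> B2) ts2"
    using c2 by (auto elim!: sorted_wrt_mono_rel[rotated])
  moreover have "support s \<inter> support t \<subseteq> B1 \<union> B2" if "s \<in> set ts1" "t \<in> set ts2" for s t
    using that sup sup2 B X by blast
  ultimately have "coherent (Node (B1 \<union> B2) (ts1 @ ts2))"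
    using kid by (simp add: sorted_wrt_append)
  moreover have "covers (Node (B1 \<union> B2) (ts1 @ ts2)) a b" if "(a, b) \<in> E" for a b
  proof (cases "(a, b) \<in> E1")
    case True
    then have "covers (Node B1 ts1) a b"
      using d1 by (simp add: rooted_decomposition_def del: covers.simps)
    then show ?thesis by auto
  next
    case False
    then have "(a, b) \<in> E2" using that E2 by blast
    then have "covers (Node B2 ts2) a b"
      using d2 by (simp add: rooted_decomposition_def del: covers.simps)
    then show ?thesis by auto
  qed
  \<comment> \<open>The sizes of \<open>S1\<close> and \<open>S2\<close> exceed
    \<open>card S\<close> by at most \<open>2 * k\<close> in total. Tripled, this is the second
    summand \<open>6 * k\<close> that adding the two bounds supplies.\<close>
  moreover have "card (B1 \<union> B2) + 6 * k \<le> 3 * card S"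
    using d1 d2 card_Un_le[of B1 B2] card_S unfolding rooted_decomposition_def by linarith
  moreover have "2 * k * (length (ts1 @ ts2) + 1) \<le> card S"
  proof -
    have "2 * k * (length (ts1 @ ts2) + 1) + 2 * k =
        2 * k * (length ts1 + 1) + 2 * k * (length ts2 + 1)"
      by (simp add: algebra_simps)
    then show ?thesis using d1 d2 card_S unfolding rooted_decomposition_def by linarith
  qed
  moreover have "2 * k * nodes (Node (B1 \<union> B2) (ts1 @ ts2)) \<le> 2 * k + card (V - S)"
  proof -
    have "2 * k * nodes (Node (B1 \<union> B2) (ts1 @ ts2)) + 2 * k =
        2 * k * nodes (Node B1 ts1) + 2 * k * nodes (Node B2 ts2)"
      by (simp add: algebra_simps)
    moreover have "card (V1 - S1) + card (V2 - S2) \<le> card (V - S)"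
    proof -
      have "card (V1 - S1) + card (V2 - S2) = card ((V1 - S1) \<union> (V2 - S2))"
        by (rule card_Un_disjoint[symmetric]) (use fins X S1 in auto)
      also have "\<dots> \<le> card (V - S)"
        by (rule card_mono) (use fins V S1 S2 in auto)
      finally show ?thesis .
    qed
    ultimately show ?thesis using d1 d2 unfolding rooted_decomposition_def by linarith
  qed
  moreover have "occurrences v (Node (B1 \<union> B2) (ts1 @ ts2)) \<le> 1 + card (E `` {v})"
    if v: "v \<in> V" for v
  proof -
    let ?o1 = "occurrences v (Node B1 ts1)" and ?o2 = "occurrences v (Node B2 ts2)"
    have o1: "v \<in> V1 \<Longrightarrow> ?o1 \<le> 1 + card (E1 `` {v})" "v \<notin> V1 \<Longrightarrow> ?o1 = 0"
      using d1 occurrences_eq_0[of v "Node B1 ts1"] unfolding rooted_decomposition_def by auto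
    have o2: "v \<in> V2 \<Longrightarrow> ?o2 \<le> 1 + card (E2 `` {v})" "v \<notin> V2 \<Longrightarrow> ?o2 = 0"
      using d2 occurrences_eq_0[of v "Node B2 ts2"] unfolding rooted_decomposition_def by auto
    have "E `` {v} = E1 `` {v} \<union> E2 `` {v}" using E1 E2 by auto
    moreover have "E1 `` {v} \<inter> E2 `` {v} = {}" using E2 by auto
    moreover have "finite (E1 `` {v})" "finite (E2 `` {v})" using fins E1 E2 by auto
    ultimately have deg: "card (E `` {v}) = card (E1 `` {v}) + card (E2 `` {v})"
      by (simp add: card_Un_disjoint)
    show ?thesis
    proof (cases "v \<in> X")
      case True
      then have "v \<in> B1" "v \<in> B2" "v \<in> V1" "v \<in> V2" using B by auto
      then have "occurrences v (Node (B1 \<union> B2) (ts1 @ ts2)) + 1 = ?o1 + ?o2" by simp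
      then show ?thesis using o1 o2 \<open>v \<in> V1\<close> \<open>v \<in> V2\<close> deg by linarith
    next
      case False
      have "occurrences v (Node (B1 \<union> B2) (ts1 @ ts2)) \<le> ?o1 + ?o2" by simp
      moreover have "v \<in> V1 \<and> v \<notin> V2 \<or> v \<in> V2 \<and> v \<notin> V1" using v V X False by auto
      ultimately show ?thesis using o1 o2 deg by linarith
    qed
  qed
  moreover have "S \<subseteq> B1 \<union> B2" using B S1 S2 S V by blast
  moreover have "support (Node (B1 \<union> B2) (ts1 @ ts2)) = V"
    using d1 d2 V by (auto simp: rooted_decomposition_def)
  moreover have "\<forall>t\<in>set (ts1 @ ts2). bounded (72 * k) 11 t"
    using d1 d2 unfolding rooted_decomposition_def by auto
  ultimately show ?thesis unfolding rooted_decomposition_def by blast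
qed

text \<open>The consequence of small treewidth on which the recursion rests. It speaks of the whole
  graph, because a separation for \<open>S\<close> can be intersected with the vertex set of any
  subgraph containing \<open>S\<close>.\<close>

definition separable :: "nat \<Rightarrow> 'a set \<Rightarrow> ('a \<times> 'a) set \<Rightarrow> bool" where
  "separable k V E \<longleftrightarrow> (\<forall>S. S \<subseteq> V \<longrightarrow> 12 * k \<le> card S \<longrightarrow>
     (\<exists>A C X. A \<union> C \<union> X = V \<and> A \<inter> C = {} \<and> X \<inter> (A \<union> C) = {} \<and> card X \<le> k \<and>
       (\<forall>a\<in>A. \<forall>c\<in>C. (a, c) \<notin> E) \<and>
       card (S - X) \<le> 3 * card (A \<inter> S) \<and> card (S - X) \<le> 3 * card (C \<inter> S)))"

text \<open>Each vertex of \<open>S\<close> that is passed on to the child bag uses up one incident edge, namely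
  the one to its chosen neighbour in \<open>N\<close>. This pays for the additional node in its spread.\<close>

lemma rooted_decomposition_extend:
  assumes fin: "finite V" and E: "E \<subseteq> V \<times> V" "sym E" and S: "S \<subseteq> V" "4 * k \<le> card S"
    and R: "R = {v \<in> S. \<exists>w\<in>V - S. (v, w) \<in> E}"
    and f: "\<And>v. v \<in> R \<Longrightarrow> f v \<in> V - S \<and> (v, f v) \<in> E"
    and N: "f ` R \<subseteq> N" "N \<subseteq> V - S" "2 * k \<le> card N"
    and V': "V' = R \<union> (V - S)" and S': "S' = R \<union> N" "card S' \<le> 24 * k"
    and E': "E' = E \<inter> V' \<times> V' - S \<times> S - {(v, f v) |v. v \<in> R} - {(f v, v) |v. v \<in> R}"
    and k: "1 \<le> k"
    and d: "rooted_decomposition k V' E' S' B ts"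
  shows "rooted_decomposition k V E S S [Node B ts]"
proof -
  have fins: "finite E" "finite S" "finite N"
    using fin E S N by (auto intro: finite_subset)
  have sup: "support (Node B ts) = V'" and BS: "S' \<subseteq> B"
    using d by (simp_all add: rooted_decomposition_def)
  have RS: "R \<subseteq> S" using R by blast
  have "coherent (Node B ts)" using d by (simp add: rooted_decomposition_def)
  moreover have "V' \<inter> S \<subseteq> B" using BS S' V' by blast
  ultimately have "coherent (Node S [Node B ts])"
    using sup by (simp del: coherent.simps support.simps add: coherent.simps[of S])
  moreover have "covers (Node S [Node B ts]) a b" if ab: "(a, b) \<in> E" for a b
  proof (cases "a \<in> S \<and> b \<in> S")
    case True
    then show ?thesis by simp
  next
    case False
    have "(b, a) \<in> E" using ab E symD by metis
    \<comment> \<open>An end in \<open>S\<close> of an edge that leaves \<open>S\<close> belongs to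
      \<open>R\<close>. So an edge not covered by the root bag lies within \<open>V'\<close>, and it
      is missing from \<open>E'\<close> only if it is a chosen edge, whose ends both lie in
      \<open>S'\<close>.\<close>
    have V'ab: "a \<in> V'" "b \<in> V'"
      using False ab \<open>(b, a) \<in> E\<close> E R V' by auto
    show ?thesis
    proof (cases "(a, b) \<in> E'")
      case True
      then have "covers (Node B ts) a b" using d by (simp add: rooted_decomposition_def)
      then show ?thesis by (simp del: covers.simps add: covers.simps[of S])
    next
      case False': False
      then have "a \<in> R \<and> b = f a \<or> b \<in> R \<and> a = f b" using False ab V'ab E' by auto
      then have "a \<in> S' \<and> b \<in> S'" using N S' by auto
      then show ?thesis using BS by auto
    qed
  qed
  moreover have "card S + 6 * k \<le> 3 * card S" using S by linarith
  \<comment> \<open>With one child the left side is \<open>4 * k\<close>, which is where the lower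
    bound on \<open>card S\<close> comes from.\<close>
  moreover have "2 * k * (length [Node B ts] + 1) \<le> card S" using S by simp
  moreover have "bounded (72 * k) 11 (Node B ts)"
    by (rule rooted_decomposition_bounded[OF d S'(2) k])
  moreover have "2 * k * nodes (Node S [Node B ts]) \<le> 2 * k + card (V - S)"
  proof -
    \<comment> \<open>The vertices of \<open>N\<close> move into the prescribed set of the child.
      There are at least \<open>2 * k\<close> of them, which pays for the new root.\<close>
    have "V' - S' = (V - S) - N" using V' S' RS by blast
    moreover have "card ((V - S) - N) = card (V - S) - card N"
      using N fins by (simp add: card_Diff_subset)
    moreover have "card N \<le> card (V - S)" using N fin by (simp add: card_mono)
    ultimately have "card (V' - S') + card N = card (V - S)" by simp
    then have "card (V' - S') + 2 * k \<le> card (V - S)" using N by linarith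
    moreover have "2 * k * nodes (Node S [Node B ts]) = 2 * k + 2 * k * nodes (Node B ts)"
      by simp
    ultimately show ?thesis using d unfolding rooted_decomposition_def by linarith
  qed
  moreover have "occurrences v (Node S [Node B ts]) \<le> 1 + card (E `` {v})" if v: "v \<in> V" for v
  proof -
    have o: "occurrences v (Node S [Node B ts]) =
        (if v \<in> S then 1 else 0) + occurrences v (Node B ts)" by simp
    have fE: "finite (E `` {v})" using fins by auto
    consider "v \<in> S" "v \<notin> R" | "v \<in> R" | "v \<notin> S" by blast
    then show ?thesis
    proof cases
      case 1
      then have "v \<notin> support (Node B ts)" using sup V' by simp
      then show ?thesis using o by (simp add: occurrences_eq_0 del: occurrences.simps)
    next
      case 2
      have "E' `` {v} \<subset> E `` {v}" using E' f[OF 2] 2 by blast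
      then have "card (E' `` {v}) < card (E `` {v})" using fE by (rule psubset_card_mono[rotated])
      moreover have "occurrences v (Node B ts) \<le> 1 + card (E' `` {v})"
        using d 2 V' by (simp add: rooted_decomposition_def)
      ultimately show ?thesis using o by simp
    next
      case 3
      have "card (E' `` {v}) \<le> card (E `` {v})" using fE E' by (intro card_mono) auto
      moreover have "occurrences v (Node B ts) \<le> 1 + card (E' `` {v})"
        using d 3 v V' by (simp add: rooted_decomposition_def)
      ultimately show ?thesis using o 3 by simp
    qed
  qed
  moreover have "support (Node S [Node B ts]) = V"
    using sup V' RS S by (simp del: support.simps add: support.simps[of S]) blast
  ultimately show ?thesis unfolding rooted_decomposition_def by simp
qed

text \<open>All remaining vertices fit into one child bag of size at most \<open>24 * k\<close>, and
  there are enough of them to pay for a second node. A vertex in both bags lies in \<open>R\<close>,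
  so it has an incident edge and its spread 2 is allowed.\<close>

lemma rooted_decomposition_two_bags:
  assumes fin: "finite V" and E: "E \<subseteq> V \<times> V" "sym E" and S: "S \<subseteq> V" "4 * k \<le> card S"
    and R: "R = {v \<in> S. \<exists>w\<in>V - S. (v, w) \<in> E}"
    and le: "2 * k \<le> card (V - S)" "card (V - S) \<le> 12 * k" "card S \<le> 12 * k"
  shows "rooted_decomposition k V E S S [Node (R \<union> (V - S)) []]"
proof -
  have fins: "finite E" "finite S" using fin E S by (auto intro: finite_subset)
  have "card R \<le> card S" using R fins by (intro card_mono) auto
  then have "card (R \<union> (V - S)) \<le> 72 * k" using card_Un_le[of R "V - S"] le by linarith
  moreover have "covers (Node S [Node (R \<union> (V - S)) []]) a b" if ab: "(a, b) \<in> E" for a b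
  proof -
    have "(b, a) \<in> E" using ab E symD by metis
    then show ?thesis using ab E R by auto
  qed
  moreover have "occurrences v (Node S [Node (R \<union> (V - S)) []]) \<le> 1 + card (E `` {v})"
    if "v \<in> V" for v
  proof (cases "v \<in> R")
    case True
    then have "E `` {v} \<noteq> {}" using R by auto
    then have "0 < card (E `` {v})" using fins by (auto simp: card_gt_0_iff)
    then show ?thesis using True R by simp
  qed (use R in auto)
  moreover have "card S + 6 * k \<le> 3 * card S" using S by linarith
  moreover have "R \<subseteq> S" using R by blast
  moreover have "support (Node S [Node (R \<union> (V - S)) []]) = V" using \<open>R \<subseteq> S\<close> S by auto
  moreover have "coherent (Node S [Node (R \<union> (V - S)) []])" by auto
  moreover have "2 * k * nodes (Node S [Node (R \<union> (V - S)) []]) \<le> 2 * k + card (V - S)"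
    "2 * k * (length [Node (R \<union> (V - S)) []] + 1) \<le> card S"
    using S le by simp_all
  ultimately show ?thesis unfolding rooted_decomposition_def by simp
qed

section \<open>The recursion\<close>

theorem rooted_decomposition_exists:
  assumes k: "1 \<le> k" and sepG: "separable k VG EG" and finG: "finite VG"
  shows "V \<subseteq> VG \<Longrightarrow> E \<subseteq> EG \<inter> V \<times> V \<Longrightarrow> sym E \<Longrightarrow> S \<subseteq> V \<Longrightarrow> 4 * k \<le> card S \<Longrightarrow>
    card S \<le> 24 * k \<Longrightarrow> \<exists>B ts. rooted_decomposition k V E S B ts"
\<comment> \<open>Edges have to be counted too: if all vertices of \<open>S\<close> have neighbours
  outside \<open>S\<close>, extending by a new root leaves \<open>V\<close> unchanged and only
  deletes edges.\<close>
proof (induction "card V + card E" arbitrary: V E S rule: less_induct)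
  case less
  have fin: "finite V" using less.prems finG finite_subset by blast
  then have finE: "finite E" using less.prems(2) by (meson finite_SigmaI finite_subset le_inf_iff)
  have finS: "finite S" using fin less.prems finite_subset by blast
  have E: "E \<subseteq> V \<times> V" "sym E" using less.prems by auto
  note S = less.prems(4,5)
  have S0: "S \<noteq> {}" using S k by auto
  consider "card (V - S) < 2 * k"
    | "2 * k \<le> card (V - S)" "card (V - S) \<le> 12 * k" "card S \<le> 12 * k"
    | "12 * k < card (V - S)" "card S \<le> 12 * k"
    | "12 * k < card S" by linarith
  then show ?case
  proof cases
    case 1
    have "card V = card (V - S) + card S"
      using S fin finS by (metis card_Diff_subset card_mono le_add_diff_inverse2)
    \<comment> \<open>A single bag \<open>V\<close> suffices: \<open>card V + 6 * k\<close> is below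
      \<open>card S + 8 * k\<close>, and \<open>8 * k \<le> 2 * card S\<close>.\<close>
    then have "rooted_decomposition k V E S V []"
      using 1 S E by (auto simp: rooted_decomposition_def)
    then show ?thesis by blast
  next
    case 2
    then show ?thesis using rooted_decomposition_two_bags[OF fin E S refl] by blast
  next
    case 3
    define R where "R = {v \<in> S. \<exists>w\<in>V - S. (v, w) \<in> E}"
    then have "\<forall>v\<in>R. \<exists>w. w \<in> V - S \<and> (v, w) \<in> E" by blast
    then obtain f where f: "\<And>v. v \<in> R \<Longrightarrow> f v \<in> V - S \<and> (v, f v) \<in> E" by metis
    have RS: "R \<subseteq> S" by (auto simp: R_def)
    then have R_le: "card R \<le> 12 * k" using 3 card_mono[OF finS] le_trans by blast
    have finR: "finite R" using RS finS finite_subset by blast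
    have "card (f ` R) \<le> 12 * k" using card_image_le[OF finR] R_le le_trans by blast
    \<comment> \<open>There are at most \<open>12 * k\<close> chosen neighbours. Filling up to
      exactly \<open>12 * k\<close> vertices keeps \<open>card (R \<union> N)\<close> between
      \<open>4 * k\<close> and \<open>24 * k\<close>.\<close>
    then obtain N where N: "f ` R \<subseteq> N" "N \<subseteq> V - S" "card N = 12 * k"
      using exists_subset_between[of "f ` R" "12 * k" "V - S"] 3 f fin by auto
    define V' where "V' = R \<union> (V - S)"
    define S' where "S' = R \<union> N"
    define E' where
      "E' = E \<inter> V' \<times> V' - S \<times> S - {(v, f v) |v. v \<in> R} - {(f v, v) |v. v \<in> R}"
    have "finite S'" using finR N fin finite_subset[of N "V - S"] by (simp add: S'_def)
    then have "card N \<le> card S'" by (intro card_mono) (auto simp: S'_def)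
    then have S'4: "4 * k \<le> card S'" using N by linarith
    have S'24: "card S' \<le> 24 * k"
      using card_Un_le[of R N] R_le N by (simp add: S'_def)
    have V'V: "V' \<subseteq> V" using RS S by (auto simp: V'_def)
    have E'E: "E' \<subseteq> E" by (auto simp: E'_def)
    have "card V' + card E' < card V + card E"
    \<comment> \<open>If \<open>R\<close> is empty, the non-empty set \<open>S\<close> drops out of
      the vertex set. Otherwise at least one chosen edge is deleted.\<close>
    proof (cases "R = {}")
      case True
      then have "V' \<subset> V" using V'V S S0 by (auto simp: V'_def)
      then have "card V' < card V" using fin by (rule psubset_card_mono[rotated])
      then show ?thesis using card_mono[OF finE E'E] by linarith
    next
      case False
      then obtain v where "v \<in> R" by blast
      then have "(v, f v) \<in> E - E'" using f by (auto simp: E'_def)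
      then have "E' \<subset> E" using E'E by blast
      then have "card E' < card E" using finE by (rule psubset_card_mono[rotated])
      then show ?thesis using card_mono[OF fin V'V] by linarith
    qed
    moreover have "V' \<subseteq> VG" using V'V less.prems by blast
    moreover have "E' \<subseteq> EG \<inter> V' \<times> V'" using less.prems(2) by (auto simp: E'_def)
    moreover have "sym E'" using E(2) by (auto simp: E'_def sym_def)
    moreover have "S' \<subseteq> V'" using N by (auto simp: S'_def V'_def)
    ultimately obtain B ts where d: "rooted_decomposition k V' E' S' B ts"
      using less.hyps S'4 S'24 by blast
    have "rooted_decomposition k V E S S [Node B ts]"
      by (rule rooted_decomposition_extend[OF fin E S R_def _ N(1,2) _ V'_def S'_def S'24 E'_def k d])
        (use f N(3) in auto)
    then show ?thesis by blast
  next
    case 4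
    have "S \<subseteq> VG" "12 * k \<le> card S" using less.prems 4 by auto
    then obtain A0 C0 X0 where sep: "A0 \<union> C0 \<union> X0 = VG" "A0 \<inter> C0 = {}" "X0 \<inter> (A0 \<union> C0) = {}"
        "card X0 \<le> k" "\<forall>a\<in>A0. \<forall>c\<in>C0. (a, c) \<notin> EG"
        "card (S - X0) \<le> 3 * card (A0 \<inter> S)" "card (S - X0) \<le> 3 * card (C0 \<inter> S)"
      using sepG unfolding separable_def by metis
    have finX0: "finite X0" using sep(1) finG by auto
    \<comment> \<open>The separation of the whole graph is restricted to the current subgraph.
      Adding \<open>X\<close> to both \<open>S1\<close> and \<open>S2\<close> puts it into both root
      bags.\<close>
    define X where "X = X0 \<inter> V"
    define V1 where "V1 = (A0 \<union> X0) \<inter> V"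
    define V2 where "V2 = (C0 \<union> X0) \<inter> V"
    define E1 where "E1 = E \<inter> V1 \<times> V1"
    define E2 where "E2 = E - E1"
    define S1 where "S1 = (S \<inter> V1) \<union> X"
    define S2 where "S2 = (S \<inter> V2) \<union> X"
    have V: "V = V1 \<union> V2" "V1 \<inter> V2 = X" using less.prems(1) sep(1-3) by (auto simp: V1_def V2_def X_def)
    have X_le: "card X \<le> k"
      using card_mono[OF finX0, of X] sep(4) by (auto simp: X_def)
    have Esep: "a \<in> V1 \<and> b \<in> V1 \<or> a \<in> V2 \<and> b \<in> V2" if "(a, b) \<in> E" for a b
    proof -
      have "(b, a) \<in> E" using that E symD by metis
      then have "a \<in> V" "b \<in> V" "(a, b) \<in> EG" "(b, a) \<in> EG" using that less.prems(2) by auto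
      moreover have "a \<in> A0 \<union> C0 \<union> X0" "b \<in> A0 \<union> C0 \<union> X0"
        using less.prems(1) sep(1) calculation by auto
      ultimately show ?thesis using sep(5) unfolding V1_def V2_def by blast
    qed
    have E2: "E2 \<subseteq> EG \<inter> V2 \<times> V2" using Esep less.prems(2) by (auto simp: E2_def E1_def)
    have E1: "E1 \<subseteq> EG \<inter> V1 \<times> V1" using less.prems(2) by (auto simp: E1_def)
    have syms: "sym E1" "sym E2" using E(2) by (auto simp: E1_def E2_def sym_def)
    have fins: "finite V1" "finite V2" "finite X" using fin V by auto
    have cS: "card S = card (S - X0) + card (S \<inter> X)"
    proof -
      have "S \<inter> X0 = S \<inter> X" using S by (auto simp: X_def)
      then show ?thesis using card_Diff_subset_Int[of S X0] finS card_mono[OF finS, of "S \<inter> X0"]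
        by (simp add: Int_commute)
    qed
    have "card (S \<inter> X) \<le> card X" using fins by (simp add: card_mono)
    note cS = cS this
    have cS1: "card S1 = card (A0 \<inter> S) + card X"
    proof -
      have "S1 = (A0 \<inter> S) \<union> X" using S by (auto simp: S1_def V1_def X_def)
      moreover have "(A0 \<inter> S) \<inter> X = {}" using sep(3) by (auto simp: X_def)
      ultimately show ?thesis using finS fins by (simp add: card_Un_disjoint)
    qed
    have cS2: "card S2 = card (C0 \<inter> S) + card X"
    proof -
      have "S2 = (C0 \<inter> S) \<union> X" using S by (auto simp: S2_def V2_def X_def)
      moreover have "(C0 \<inter> S) \<inter> X = {}" using sep(3) by (auto simp: X_def)
      ultimately show ?thesis using finS fins by (simp add: card_Un_disjoint)
    qed
    have split: "card (A0 \<inter> S) + card (C0 \<inter> S) = card (S - X0)"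
    proof -
      have "S - X0 = (A0 \<inter> S) \<union> (C0 \<inter> S)" using sep(1,3) \<open>S \<subseteq> VG\<close> by blast
      moreover have "(A0 \<inter> S) \<inter> (C0 \<inter> S) = {}" using sep(2) by blast
      ultimately show ?thesis using finS by (simp add: card_Un_disjoint)
    qed
    \<comment> \<open>A third of \<open>S - X0\<close> together with all of \<open>X\<close> amounts
      to at least a third of \<open>S\<close>, hence to \<open>4 * k\<close> as
      \<open>card S\<close> exceeds \<open>12 * k\<close>. From above, each side gets at most two
      thirds of \<open>24 * k\<close> and the at most \<open>k\<close> vertices of
      \<open>X\<close>.\<close>
    have bounds: "4 * k \<le> card S1" "4 * k \<le> card S2" "card S1 \<le> 24 * k" "card S2 \<le> 24 * k"
      using cS cS1 cS2 split sep(6,7) X_le 4 less.prems(6) by linarith+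
    \<comment> \<open>Each side has a vertex of \<open>S\<close> of its own, which is absent from
      the other part, so both recursive calls get fewer vertices.\<close>
    have pos: "0 < card (A0 \<inter> S)" "0 < card (C0 \<inter> S)"
      using cS sep(6,7) X_le 4 by linarith+
    have subs: "V1 \<subset> V" "V2 \<subset> V"
    proof -
      obtain a where "a \<in> A0 \<inter> S" using pos(1) by (metis card_gt_0_iff ex_in_conv)
      then have "a \<in> V - V2" using S sep(2,3) by (auto simp: V2_def)
      then show "V2 \<subset> V" using V by blast
      obtain c where "c \<in> C0 \<inter> S" using pos(2) by (metis card_gt_0_iff ex_in_conv)
      then have "c \<in> V - V1" using S sep(2,3) by (auto simp: V1_def)
      then show "V1 \<subset> V" using V by blast
    qed
    have "card E1 \<le> card E" "card E2 \<le> card E"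
      using finE by (auto simp: E1_def E2_def intro: card_mono)
    then have "card V1 + card E1 < card V + card E" "card V2 + card E2 < card V + card E"
      using psubset_card_mono[OF fin] subs by (auto intro: add_less_le_mono)
    moreover have "S1 \<subseteq> V1" "S2 \<subseteq> V2" using V by (auto simp: S1_def S2_def)
    ultimately obtain B1 ts1 B2 ts2 where d:
      "rooted_decomposition k V1 E1 S1 B1 ts1" "rooted_decomposition k V2 E2 S2 B2 ts2"
      using less.hyps[of V1 E1 S1] less.hyps[of V2 E2 S2] E1 E2 syms bounds subs less.prems(1)
      by blast
    have "rooted_decomposition k V E S (B1 \<union> B2) (ts1 @ ts2)"
      by (rule rooted_decomposition_merge[OF fin E(1) V S(1) _ X_le E1_def E2_def S1_def S2_def d])
        (rule Esep)
    then show ?thesis by blast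
  qed
qed

section \<open>From trees of bags to tree-decompositions\<close>

text \<open>The guards \<open>x \<noteq> r\<close> and \<open>y \<noteq> r\<close> keep an arbitrary
  value of \<open>p\<close> at the root from creating an arc.\<close>

definition parent_graph :: "'b set \<Rightarrow> 'b \<Rightarrow> ('b \<Rightarrow> 'b) \<Rightarrow> 'b pair_pre_digraph" where
  "parent_graph N r p = \<lparr>pverts = N,
     parcs = {(x, y). x \<in> N \<and> y \<in> N \<and> (x \<noteq> r \<and> y = p x \<or> y \<noteq> r \<and> x = p y)}\<rparr>"

lemma pverts_parent_graph: "pverts (parent_graph N r p) = N"
  by (simp add: parent_graph_def)

lemma pcas_nth_Suc:
  assumes "pcas u es v" "Suc i < length es"
  shows "fst (es ! Suc i) = snd (es ! i)"
  using assms
proof (induction es arbitrary: u i)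
  case (Cons e es)
  then show ?case by (cases i; cases es) auto
qed simp

lemma pcas_last: "pcas u es v \<Longrightarrow> es \<noteq> [] \<Longrightarrow> snd (last es) = v"
  by (induction es arbitrary: u) (auto split: if_splits)

text \<open>Indices modulo the length treat the closing point of the walk like every other vertex,
  so that an extremal vertex of a cycle may sit anywhere on it.\<close>

lemma closed_pcas_nth:
  assumes "pcas u es u" "i < length es"
  shows "fst (es ! (Suc i mod length es)) = snd (es ! i)"
proof (cases "Suc i = length es")
  case True
  then have "es \<noteq> []" by auto
  moreover have "i = length es - 1" using True by simp
  ultimately have "snd (es ! i) = u" using pcas_last[OF assms(1)] by (simp add: last_conv_nth)
  moreover have "fst (es ! 0) = u" using assms \<open>es \<noteq> []\<close> by (cases es) auto
  ultimately show ?thesis using True by simp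
next
  case False
  then show ?thesis using pcas_nth_Suc[OF assms(1)] assms(2) by simp
qed

text \<open>The function \<open>h\<close> decreases strictly towards the root. This makes climbing
  terminate and excludes cycles.\<close>

locale parent_tree =
  fixes N :: "'b set" and r :: 'b and p :: "'b \<Rightarrow> 'b" and h :: "'b \<Rightarrow> nat"
  assumes finite_N: "finite N" and root: "r \<in> N"
    and parent_in: "\<And>x. x \<in> N \<Longrightarrow> x \<noteq> r \<Longrightarrow> p x \<in> N"
    and height: "\<And>x. x \<in> N \<Longrightarrow> x \<noteq> r \<Longrightarrow> h (p x) < h x"
begin

abbreviation T :: "'b pair_pre_digraph" where "T \<equiv> parent_graph N r p"

lemma pair_graph_T: "pair_graph T"
proof
  have "parcs T \<subseteq> N \<times> N" by (auto simp: parent_graph_def)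
  then show "finite (parcs T)" using finite_N finite_subset by blast
  show "symmetric T" by (auto simp: symmetric_def parent_graph_def intro!: symI)
  fix e assume e: "e \<in> parcs T"
  show "fst e \<noteq> snd e"
  proof
    assume "fst e = snd e"
    then obtain x where "x \<in> N" "x \<noteq> r" "x = p x" using e by (auto simp: parent_graph_def)
    then show False using height[of x] by simp
  qed
qed (auto simp: parent_graph_def finite_N)

text \<open>Climbing from any node of \<open>M\<close> along parents in \<open>M\<close> ends at a
  topmost node of \<open>M\<close>. By assumption \<open>top\<close> there is only one, so any two
  nodes are joined through it.\<close>

lemma connected_induce:
  assumes M: "M \<subseteq> N" "M \<noteq> {}"
    and top: "\<And>x y. x \<in> M \<Longrightarrow> y \<in> M \<Longrightarrow> x = r \<or> p x \<notin> M \<Longrightarrow> y = r \<or> p y \<notin> M \<Longrightarrow> x = y"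
  shows "connected (T \<restriction> M)"
proof -
  let ?R = "(arcs_ends (T \<restriction> M))\<^sup>s"
  have arc: "(x, p x) \<in> ?R \<and> (p x, x) \<in> ?R" if "x \<in> M" "x \<noteq> r" "p x \<in> M" for x
    using that M by (force simp: symcl_def arcs_ends_conv parent_graph_def)
  have climb: "\<exists>y\<in>M. (y = r \<or> p y \<notin> M) \<and> (x, y) \<in> rtrancl_on M ?R \<and> (y, x) \<in> rtrancl_on M ?R"
    if "x \<in> M" for x
    using that
  proof (induction "h x" arbitrary: x rule: less_induct)
    case less
    show ?case
    proof (cases "x = r \<or> p x \<notin> M")
      case True
      then show ?thesis using less by auto
    next
      case False
      then have "h (p x) < h x" using height less M by blast
      then obtain y where y: "y \<in> M" "y = r \<or> p y \<notin> M" "(p x, y) \<in> rtrancl_on M ?R"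
          "(y, p x) \<in> rtrancl_on M ?R"
        using less.hyps False by metis
      have "(x, y) \<in> rtrancl_on M ?R" "(y, x) \<in> rtrancl_on M ?R"
        using y arc[of x] False less.prems
        by (meson converse_rtrancl_on_into_rtrancl_on rtrancl_on_into_rtrancl_on)+
      then show ?thesis using y by blast
    qed
  qed
  show ?thesis
    unfolding connected_conv
  proof (intro conjI ballI)
    show "verts (T \<restriction> M) \<noteq> {}" using M by simp
    fix u v assume "u \<in> verts (T \<restriction> M)" "v \<in> verts (T \<restriction> M)"
    then have uv: "u \<in> M" "v \<in> M" by auto
    obtain a where a: "a \<in> M" "a = r \<or> p a \<notin> M" "(u, a) \<in> rtrancl_on M ?R"
      using climb[OF uv(1)] by blast
    obtain b where b: "b \<in> M" "b = r \<or> p b \<notin> M" "(b, v) \<in> rtrancl_on M ?R"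
      using climb[OF uv(2)] by blast
    have "a = b" using top a b by blast
    then show "(u, v) \<in> rtrancl_on (verts (T \<restriction> M)) ?R"
      using a b by (auto intro: rtrancl_on_trans)
  qed
qed

text \<open>Both neighbours on a cycle of a vertex of maximal height are its parent.\<close>

lemma no_cycle:
  assumes "pre_digraph.cycle T es" "3 \<le> length es"
  shows False
proof -
  interpret T: pair_graph T by (rule pair_graph_T)
  obtain u where u: "pcas u es u" "set es \<subseteq> parcs T" "distinct (tl (pawalk_verts u es))"
    using assms(1) by (auto simp: T.cycle_def T.awalk_def)
  let ?n = "length es"
  have "tl (pawalk_verts v es) = map snd es" if "pcas v es w" for v w es
    using that
  proof (induction es arbitrary: v)
    case (Cons e es)
    then show ?case by (cases es) auto
  qed simp
  then have dist: "distinct (map snd es)" using u by metis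
  let ?H = "(\<lambda>i. h (snd (es ! i))) ` {..<?n}"
  have "Max ?H \<in> ?H" using assms(2) by (intro Max_in) (auto simp: lessThan_empty_iff)
  then obtain i where i: "i < ?n" "h (snd (es ! i)) = Max ?H" by auto
  have mx: "h (snd (es ! j)) \<le> h (snd (es ! i))" if "j < ?n" for j
    using that i by (auto intro!: Max_ge)
  \<comment> \<open>\<open>j\<close> and \<open>l\<close> are the cyclic predecessor and successor
    of \<open>i\<close>. They differ because the cycle has at least three arcs, yet both turn out to
    be the index of an arc that ends in the parent of \<open>?m\<close>.\<close>
  define j where "j = (if i = 0 then ?n - 1 else i - 1)"
  define l where "l = Suc i mod ?n"
  have "l < ?n" unfolding l_def by (rule mod_less_divisor) (use i in auto)
  then have jl: "j < ?n" "l < ?n" "Suc j mod ?n = i" using i by (auto simp: j_def)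
  have ne: "j \<noteq> l"
    using i assms(2) by (auto simp: j_def l_def mod_Suc split: if_splits)
  let ?m = "snd (es ! i)" and ?a = "snd (es ! j)" and ?b = "snd (es ! l)"
  have par: "p ?m = c" if c: "(c, ?m) \<in> parcs T \<or> (?m, c) \<in> parcs T" "h c \<le> h ?m" for c
    using c height by (auto simp: parent_graph_def) (metis leD)+
  have "es ! i = (?a, ?m)"
    using closed_pcas_nth[OF u(1) jl(1)] jl(3) by (metis prod.collapse)
  then have "(?a, ?m) \<in> parcs T" using u(2) i nth_mem by fastforce
  then have "p ?m = ?a" using par mx[OF jl(1)] by blast
  moreover have "es ! l = (?m, ?b)"
    using closed_pcas_nth[OF u(1) i(1)] by (metis prod.collapse l_def)
  then have "(?m, ?b) \<in> parcs T" using u(2) jl nth_mem by fastforce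
  then have "p ?m = ?b" using par mx[OF jl(2)] by blast
  ultimately have "map snd es ! j = map snd es ! l" using jl by simp
  then show False using nth_eq_iff_index_eq[OF dist, of j l] jl ne by simp
qed

lemma undirected_tree_T: "undirected_tree T"
proof -
  interpret T: pair_graph T by (rule pair_graph_T)
  have "T \<restriction> N = with_proj T"
    by (auto simp: induce_subgraph_def with_proj_def parent_graph_def)
  moreover have "connected (T \<restriction> N)"
    using root parent_in by (intro connected_induce) auto
  ultimately have "connected T" by simp
  then show ?thesis using pair_graph_T no_cycle by (auto simp: undirected_tree_def)
qed

lemma out_degree_T: "out_degree T x \<le> Suc (card {y \<in> N. y \<noteq> r \<and> p y = x})"
proof -
  let ?Y = "{y \<in> N. y \<noteq> r \<and> p y = x}"
  have "out_arcs T x \<subseteq> Pair x ` insert (p x) ?Y"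
    by (auto simp: out_arcs_def parent_graph_def)
  then have "out_degree T x \<le> card (Pair x ` insert (p x) ?Y)"
    unfolding out_degree_def using finite_N by (intro card_mono) auto
  also have "\<dots> \<le> card (insert (p x) ?Y)" using finite_N by (intro card_image_le) auto
  also have "\<dots> \<le> Suc (card ?Y)" by (rule card_insert_le_m1) auto
  finally show ?thesis .
qed

end

section \<open>Positions in a tree of bags\<close>

text \<open>Nodes are addressed by the list of child indices on the way from the root. This keeps
  equal subtrees apart, makes \<open>butlast\<close> the parent map and the length of the list the
  depth.\<close>

fun subtree_at :: "'a bag_tree \<Rightarrow> nat list \<Rightarrow> 'a bag_tree option" where
  "subtree_at t [] = Some t"
| "subtree_at (Node B ts) (i # q) = (if i < length ts then subtree_at (ts ! i) q else None)"

definition positions :: "'a bag_tree \<Rightarrow> nat list set" where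
  "positions t = {q. subtree_at t q \<noteq> None}"

definition bag_at :: "'a bag_tree \<Rightarrow> nat list \<Rightarrow> 'a set" where
  "bag_at t q = (case subtree_at t q of None \<Rightarrow> {} | Some s \<Rightarrow> root_bag s)"

lemma bag_at_simps [simp]:
  "bag_at t [] = root_bag t"
  "bag_at (Node B ts) (i # q) = (if i < length ts then bag_at (ts ! i) q else {})"
  by (auto simp: bag_at_def)

lemma Nil_in_positions [simp]: "[] \<in> positions t"
  by (simp add: positions_def)

lemma Cons_in_positions [simp]:
  "i # q \<in> positions (Node B ts) \<longleftrightarrow> i < length ts \<and> q \<in> positions (ts ! i)"
  by (simp add: positions_def)

lemma in_bag_at_imp_position: "v \<in> bag_at t q \<Longrightarrow> q \<in> positions t"
  by (auto simp: bag_at_def positions_def split: option.splits)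

lemma subtree_at_append:
  "subtree_at t (q @ q') = (case subtree_at t q of None \<Rightarrow> None | Some s \<Rightarrow> subtree_at s q')"
  by (induction t q rule: subtree_at.induct) auto

lemma butlast_in_positions: "q \<in> positions t \<Longrightarrow> butlast q \<in> positions t"
  by (cases q rule: rev_cases) (auto simp: positions_def subtree_at_append split: option.splits)

lemma positions_Node:
  "{q \<in> positions (Node B ts). P q} =
    {q. q = [] \<and> P []} \<union> (\<Union>i<length ts. Cons i ` {q \<in> positions (ts ! i). P (i # q)})"
proof (intro set_eqI)
  fix q show "q \<in> {q \<in> positions (Node B ts). P q} \<longleftrightarrow>
      q \<in> {q. q = [] \<and> P []} \<union> (\<Union>i<length ts. Cons i ` {q \<in> positions (ts ! i). P (i # q)})"
    by (cases q) auto
qed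

lemma finite_positions: "finite (positions t)"
proof (induction t)
  case (Node B ts)
  then show ?case using positions_Node[of B ts "\<lambda>_. True"] by auto
qed

text \<open>The predicate \<open>P\<close> lets one recursion serve both for the number of nodes and
  for the number of bags containing a given vertex.\<close>

lemma card_positions_Node:
  "card {q \<in> positions (Node B ts). P q} =
    (if P [] then 1 else 0) + (\<Sum>i<length ts. card {q \<in> positions (ts ! i). P (i # q)})"
proof -
  have "card (\<Union>i<length ts. Cons i ` {q \<in> positions (ts ! i). P (i # q)}) =
      (\<Sum>i<length ts. card (Cons i ` {q \<in> positions (ts ! i). P (i # q)}))"
    by (rule card_UN_disjoint) (auto simp: finite_positions)
  also have "\<dots> = (\<Sum>i<length ts. card {q \<in> positions (ts ! i). P (i # q)})"
    by (simp add: card_image)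
  finally have *: "card (\<Union>i<length ts. Cons i ` {q \<in> positions (ts ! i). P (i # q)}) = \<dots>" .
  have "card {q \<in> positions (Node B ts). P q} = card {q :: nat list. q = [] \<and> P []} +
      card (\<Union>i<length ts. Cons i ` {q \<in> positions (ts ! i). P (i # q)})"
    unfolding positions_Node by (rule card_Un_disjoint) (auto simp: finite_positions)
  moreover have "{q :: nat list. q = [] \<and> P []} = (if P [] then {[]} else {})" by auto
  ultimately show ?thesis using * by simp
qed

lemma card_positions: "card (positions t) = nodes t"
proof (induction t)
  case (Node B ts)
  have "card (positions (Node B ts)) = 1 + (\<Sum>i<length ts. card (positions (ts ! i)))"
    using card_positions_Node[of B ts "\<lambda>_. True"] by simp
  also have "\<dots> = 1 + (\<Sum>i<length ts. nodes (ts ! i))" using Node by simp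
  finally show ?case by (simp add: sum_list_sum_nth atLeast0LessThan)
qed

lemma card_bag_positions: "card {q \<in> positions t. v \<in> bag_at t q} = occurrences v t"
proof (induction t)
  case (Node B ts)
  have "card {q \<in> positions (Node B ts). v \<in> bag_at (Node B ts) q} =
      (if v \<in> B then 1 else 0) + (\<Sum>i<length ts. card {q \<in> positions (ts ! i). v \<in> bag_at (ts ! i) q})"
    by (simp add: card_positions_Node)
  also have "\<dots> = (if v \<in> B then 1 else 0) + (\<Sum>i<length ts. occurrences v (ts ! i))"
    using Node by simp
  finally show ?case by (simp add: sum_list_sum_nth atLeast0LessThan)
qed

lemma support_eq: "support t = (\<Union>q\<in>positions t. bag_at t q)"
proof (induction t)
  case (Node B ts)
  have "(\<Union>q\<in>positions (Node B ts). bag_at (Node B ts) q) =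
      B \<union> (\<Union>i<length ts. \<Union>q\<in>positions (ts ! i). bag_at (ts ! i) q)"
    using positions_Node[of B ts "\<lambda>_. True"] by auto
  also have "\<dots> = B \<union> (\<Union>i<length ts. support (ts ! i))" using Node by auto
  also have "(\<Union>i<length ts. support (ts ! i)) = (\<Union>t\<in>set ts. support t)"
    by (force simp: set_conv_nth)
  finally show ?case by simp
qed

lemma covers_imp_bag: "covers t a b \<Longrightarrow> \<exists>q\<in>positions t. a \<in> bag_at t q \<and> b \<in> bag_at t q"
proof (induction t)
  case (Node B ts)
  show ?case
  proof (cases "a \<in> B \<and> b \<in> B")
    case True
    then show ?thesis by (intro bexI[of _ "[]"]) auto
  next
    case False
    then obtain i where i: "i < length ts" "covers (ts ! i) a b"
      using Node.prems by (auto simp: in_set_conv_nth)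
    then obtain q where "q \<in> positions (ts ! i)" "a \<in> bag_at (ts ! i) q" "b \<in> bag_at (ts ! i) q"
      using Node.IH[of "ts ! i"] by auto
    then show ?thesis using i by (intro bexI[of _ "i # q"]) auto
  qed
qed

lemma bounded_subtree: "bounded w d t \<Longrightarrow> subtree_at t q = Some s \<Longrightarrow> bounded w d s"
  by (induction t q rule: subtree_at.induct) (auto split: if_splits)

text \<open>This turns the local condition \<open>coherent\<close> into the hypothesis of
  \<open>connected_induce\<close>. If \<open>v\<close> is in the root bag, a topmost position inside
  a child would compete with the root of that child, which contains \<open>v\<close> by coherence.
  Otherwise both positions lie in the same child, because siblings share only vertices of the root
  bag.\<close>

lemma topmost_position_unique:
  assumes "coherent t" "v \<in> bag_at t q" "v \<in> bag_at t q'"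
    "q = [] \<or> v \<notin> bag_at t (butlast q)" "q' = [] \<or> v \<notin> bag_at t (butlast q')"
  shows "q = q'"
  using assms
proof (induction t arbitrary: q q')
  case (Node B ts)
  have sub: "v \<in> support (ts ! i)" if "v \<in> bag_at (ts ! i) s" for i s
    unfolding support_eq using that in_bag_at_imp_position[OF that] by (rule UN_I[rotated])
  show ?case
  proof (cases "v \<in> B")
    case True
    have "s = []" if s: "v \<in> bag_at (Node B ts) s" "s = [] \<or> v \<notin> bag_at (Node B ts) (butlast s)" for s
    proof (cases s)
      case (Cons i s')
      then have i: "i < length ts" "v \<in> bag_at (ts ! i) s'" using s by (auto split: if_splits)
      then have "v \<in> bag_at (ts ! i) []" using Node.prems(1) sub True by fastforce
      moreover have "coherent (ts ! i)" using Node.prems(1) i by simp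
      moreover have "s' \<noteq> []" using s Cons True by auto
      moreover have "v \<notin> bag_at (ts ! i) (butlast s')" using s Cons i \<open>s' \<noteq> []\<close> by auto
      ultimately show ?thesis using Node.IH[of "ts ! i" s' "[]"] i by auto
    qed simp
    then show ?thesis using Node.prems by metis
  next
    case False
    then obtain i s j s' where eq: "q = i # s" "q' = j # s'"
      using Node.prems(2,3) by (cases q; cases q') auto
    have ij: "i < length ts" "j < length ts" "v \<in> bag_at (ts ! i) s" "v \<in> bag_at (ts ! j) s'"
      using Node.prems(2,3) eq by (auto split: if_splits)
    have disj: "\<not> a < b" if "a < length ts" "b < length ts" "v \<in> support (ts ! a)" "v \<in> support (ts ! b)" for a b
    proof
      assume "a < b"
      then have "support (ts ! a) \<inter> support (ts ! b) \<subseteq> B"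
        using Node.prems(1) that(2) by (simp add: sorted_wrt_iff_nth_less)
      then show False using that False by blast
    qed
    have "i = j" using disj[of i j] disj[of j i] ij sub by (meson linorder_neqE_nat)
    moreover have "s = s'"
    proof (rule Node.IH)
      show "ts ! i \<in> set ts" "coherent (ts ! i)" using ij Node.prems(1) by auto
      show "v \<in> bag_at (ts ! i) s" "v \<in> bag_at (ts ! i) s'" using ij \<open>i = j\<close> by auto
      show "s = [] \<or> v \<notin> bag_at (ts ! i) (butlast s)"
        using Node.prems(4) eq ij by (auto split: if_splits)
      show "s' = [] \<or> v \<notin> bag_at (ts ! i) (butlast s')"
        using Node.prems(5) eq ij \<open>i = j\<close> by (auto split: if_splits)
    qed
    ultimately show ?thesis using eq by simp
  qed
qed

lemma card_child_positions:
  assumes "bounded w d t"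
  shows "card {q \<in> positions t. q \<noteq> [] \<and> butlast q = s} \<le> d"
proof (cases "subtree_at t s")
  case None
  then have "s \<notin> positions t" by (simp add: positions_def)
  then have "{q \<in> positions t. q \<noteq> [] \<and> butlast q = s} = {}" using butlast_in_positions by blast
  then show ?thesis by (metis card.empty le0)
next
  case (Some u)
  obtain B ts where u: "u = Node B ts" by (cases u)
  then have d: "length ts \<le> d" using bounded_subtree[OF assms Some] by simp
  have "{q \<in> positions t. q \<noteq> [] \<and> butlast q = s} \<subseteq> (\<lambda>i. s @ [i]) ` {..<length ts}"
  proof
    fix q assume "q \<in> {q \<in> positions t. q \<noteq> [] \<and> butlast q = s}"
    then obtain i where q: "q = s @ [i]" "q \<in> positions t" by (cases q rule: rev_cases) auto
    then have "i < length ts"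
      using Some u by (auto simp: positions_def subtree_at_append split: if_splits)
    then show "q \<in> (\<lambda>i. s @ [i]) ` {..<length ts}" using q by blast
  qed
  then have "card {q \<in> positions t. q \<noteq> [] \<and> butlast q = s} \<le> card ((\<lambda>i. s @ [i]) ` {..<length ts})"
    by (intro card_mono) auto
  also have "\<dots> \<le> length ts" using card_image_le[of "{..<length ts}" "\<lambda>i. s @ [i]"] by simp
  finally show ?thesis using d by simp
qed

text \<open>The tree consists of the positions, encoded as natural numbers, with
  \<open>butlast\<close> as parent map. The degree bound exceeds the bound on the number of children
  by one for the parent.\<close>

lemma tree_decomposition_of_bag_tree:
  assumes G: "pair_graph G" and sup: "support t = pverts G" and coh: "coherent t"
    and cov: "\<And>a b. (a, b) \<in> parcs G \<Longrightarrow> covers t a b" and bd: "bounded w d t"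
  shows "\<exists>(T :: nat pair_pre_digraph) B. tree_decomposition G T B \<and>
    decomp_width T B \<le> int w - 1 \<and> decomp_degree T \<le> Suc d \<and> decomp_order T = nodes t \<and>
    (\<forall>v. spread T B v = occurrences v t)"
proof -
  define N where "N = (to_nat :: nat list \<Rightarrow> nat) ` positions t"
  define r where "r = to_nat ([] :: nat list)"
  define p where "p x = to_nat (butlast (from_nat x :: nat list))" for x :: nat
  define B where "B x = bag_at t (from_nat x)" for x :: nat
  interpret parent_tree N r p "\<lambda>x. length (from_nat x :: nat list)"
  proof
    show "finite N" by (simp add: N_def finite_positions)
    show "r \<in> N" by (simp add: N_def r_def)
    fix x assume "x \<in> N" "x \<noteq> r"
    then obtain q where q: "x = to_nat q" "q \<in> positions t" "q \<noteq> []"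
      by (auto simp: N_def r_def)
    then show "p x \<in> N" using butlast_in_positions by (auto simp: N_def p_def)
    show "length (from_nat (p x) :: nat list) < length (from_nat x :: nat list)"
      using q by (simp add: p_def)
  qed
  note pv = pverts_parent_graph
  have Nne: "N \<noteq> {}" using root by blast
  have inj: "inj_on (to_nat :: nat list \<Rightarrow> nat) X" for X by simp
  have bn: "bag_nodes T B v = to_nat ` {q \<in> positions t. v \<in> bag_at t q}" for v
    unfolding bag_nodes_def pv by (auto simp: N_def B_def)
  have "tree_decomposition G T B"
    unfolding tree_decomposition_def
  proof (intro conjI ballI)
    show "undirected_tree T" by (rule undirected_tree_T)
    show "B x \<subseteq> pverts G" if "x \<in> pverts T" for x
      using that sup by (auto simp: pv N_def B_def support_eq)
    show "case e of (v, w) \<Rightarrow> \<exists>x\<in>pverts T. v \<in> B x \<and> w \<in> B x" if e_in: "e \<in> parcs G" for e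
    proof -
      obtain a b where e: "e = (a, b)" by (cases e)
      then obtain q where "q \<in> positions t" "a \<in> bag_at t q" "b \<in> bag_at t q"
        using covers_imp_bag[OF cov] e_in by blast
      then show ?thesis using e by (auto simp: pv N_def B_def intro!: bexI[of _ "to_nat q"])
    qed
    fix v assume v: "v \<in> pverts G"
    show "connected (T \<restriction> bag_nodes T B v)"
    proof (rule connected_induce)
      show "bag_nodes T B v \<subseteq> N" by (auto simp: bag_nodes_def pv)
      show "bag_nodes T B v \<noteq> {}" using v sup by (auto simp: bn support_eq)
      fix x y assume xy: "x \<in> bag_nodes T B v" "y \<in> bag_nodes T B v"
        "x = r \<or> p x \<notin> bag_nodes T B v" "y = r \<or> p y \<notin> bag_nodes T B v"
      have top: "\<exists>q. z = to_nat q \<and> v \<in> bag_at t q \<and> (q = [] \<or> v \<notin> bag_at t (butlast q))"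
        if z: "z \<in> bag_nodes T B v" "z = r \<or> p z \<notin> bag_nodes T B v" for z
      proof -
        obtain q where q: "z = to_nat q" "q \<in> positions t" "v \<in> bag_at t q" using z bn by auto
        then have "z = r \<longleftrightarrow> q = []" "p z = to_nat (butlast q)" by (simp_all add: r_def p_def)
        then have "q = [] \<or> v \<notin> bag_at t (butlast q)"
          using z(2) butlast_in_positions[OF q(2)] by (auto simp: bn)
        then show ?thesis using q by blast
      qed
      obtain q where q: "x = to_nat q" "v \<in> bag_at t q" "q = [] \<or> v \<notin> bag_at t (butlast q)"
        using top[OF xy(1,3)] by blast
      obtain q' where q': "y = to_nat q'" "v \<in> bag_at t q'" "q' = [] \<or> v \<notin> bag_at t (butlast q')"
        using top[OF xy(2,4)] by blast
      show "x = y" using topmost_position_unique[OF coh q(2) q'(2) q(3) q'(3)] q(1) q'(1) by simp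
    qed
  qed
  moreover have "decomp_width T B \<le> int w - 1"
  proof -
    have "card (B x) \<le> w" if x: "x \<in> N" for x
    proof -
      obtain q u where "x = to_nat q" "subtree_at t q = Some u"
        using x by (auto simp: N_def positions_def)
      moreover then have "bounded w d u" using bounded_subtree[OF bd] by blast
      ultimately show ?thesis by (cases u) (simp add: B_def bag_at_def)
    qed
    then have "Max ((\<lambda>x. card (B x)) ` N) \<le> w" using finite_N Nne by simp
    then show ?thesis by (simp add: decomp_width_def pv)
  qed
  moreover have "decomp_degree T \<le> Suc d"
  proof -
    have "out_degree T x \<le> Suc d" if x: "x \<in> N" for x
    proof -
      obtain s :: "nat list" where s: "x = to_nat s" using x by (auto simp: N_def)
      have "{y \<in> N. y \<noteq> r \<and> p y = x} = to_nat ` {q \<in> positions t. q \<noteq> [] \<and> butlast q = s}"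
        by (auto simp: N_def r_def p_def s)
      then have "card {y \<in> N. y \<noteq> r \<and> p y = x} = card {q \<in> positions t. q \<noteq> [] \<and> butlast q = s}"
        by (simp add: card_image[OF inj])
      then show ?thesis using out_degree_T[of x] card_child_positions[OF bd, of s] by linarith
    qed
    then show ?thesis using finite_N Nne by (simp add: decomp_degree_def pv)
  qed
  moreover have "decomp_order T = nodes t"
    by (simp add: decomp_order_def pv N_def card_image[OF inj] card_positions)
  moreover have "spread T B v = occurrences v t" for v
    by (simp add: spread_def bn card_image[OF inj] card_bag_positions)
  ultimately show ?thesis by blast
qed

section \<open>Small cases, separators from treewidth and the final assembly\<close>

text \<open>Guarantees that the minimum in \<open>treewidth\<close> ranges over a non-empty set, and
  settles graphs with few vertices.\<close>

lemma tree_decomposition_single_bag: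
  assumes "pair_graph G"
  shows "\<exists>(T :: nat pair_pre_digraph) B. tree_decomposition G T B \<and>
    decomp_width T B \<le> int (card (pverts G)) - 1 \<and> decomp_degree T \<le> 1 \<and>
    decomp_order T = 1 \<and> (\<forall>v. spread T B v \<le> 1)"
proof -
  interpret pair_graph G by fact
  have "\<exists>(T :: nat pair_pre_digraph) B. tree_decomposition G T B \<and>
    decomp_width T B \<le> int (card (pverts G)) - 1 \<and> decomp_degree T \<le> Suc 0 \<and>
    decomp_order T = nodes (Node (pverts G) []) \<and>
    (\<forall>v. spread T B v = occurrences v (Node (pverts G) []))"
    by (rule tree_decomposition_of_bag_tree[OF assms]) (auto dest: in_arcsD1 in_arcsD2)
  then show ?thesis by (elim exE) (intro exI, auto)
qed

text \<open>The bags of an optimal decomposition have at most \<open>k\<close> vertices, so a bag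
  that is balanced with respect to \<open>S\<close> satisfies
  \<open>12 * card X \<le> card S\<close> and yields the separation.\<close>

lemma separable_of_treewidth:
  assumes G: "pair_graph G" and tw: "treewidth G + 1 \<le> int k" and k: "1 \<le> k"
  shows "separable k (pverts G) (parcs G)"
  unfolding separable_def
proof (intro allI impI)
  fix S assume S: "S \<subseteq> pverts G" "12 * k \<le> card S"
  interpret G: pair_graph G by fact
  obtain T :: "nat pair_pre_digraph" and B
    where td: "tree_decomposition G T B" and w: "decomp_width T B = treewidth G"
    using treewidth_attained tree_decomposition_single_bag[OF G] by blast
  have "undirected_tree T" using td by (simp add: tree_decomposition_def)
  then interpret T: pair_graph T by (simp add: undirected_tree_def)
  have bag: "card (B x) \<le> k" if x: "x \<in> pverts T" for x
  proof -
    have "card (B x) \<le> Max ((\<lambda>x. card (B x)) ` pverts T)"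
      using x T.pair_finite_verts by (intro Max_ge) auto
    then show ?thesis using w tw by (simp add: decomp_width_def)
  qed
  have "0 < card S" using S k by linarith
  then have "S \<noteq> {}" by auto
  then obtain x where x: "x \<in> pverts T" "balanced (parcs G) (pverts G) S (B x)"
    using balanced_bag[OF G td S(1)] by blast
  have X: "B x \<subseteq> pverts G" using td x by (auto simp: tree_decomposition_def)
  have sym: "sym (parcs G)" by (auto intro: symI G.arcs_symmetric)
  have "12 * card (B x) \<le> card S" using bag[OF x(1)] S(2) by linarith
  from balanced_imp_separation[OF G.pair_finite_verts sym S(1) x(2) X this \<open>0 < card S\<close>]
  obtain A C where AC: "A \<union> C = pverts G - B x" "A \<inter> C = {}" "\<forall>a\<in>A. \<forall>c\<in>C. (a, c) \<notin> parcs G"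
      "card (S - B x) \<le> 3 * card (A \<inter> S)" "card (S - B x) \<le> 3 * card (C \<inter> S)"
    by blast
  then have "A \<union> C \<union> B x = pverts G" "B x \<inter> (A \<union> C) = {}" using X by auto
  then show "\<exists>A C X. A \<union> C \<union> X = pverts G \<and> A \<inter> C = {} \<and> X \<inter> (A \<union> C) = {} \<and> card X \<le> k \<and>
       (\<forall>a\<in>A. \<forall>c\<in>C. (a, c) \<notin> parcs G) \<and>
       card (S - X) \<le> 3 * card (A \<inter> S) \<and> card (S - X) \<le> 3 * card (C \<inter> S)"
    using bag[OF x(1)] AC by (intro exI[of _ A] exI[of _ C] exI[of _ "B x"] conjI)
qed

text \<open>Width \<open>-1\<close> makes all bags empty, whereas every vertex lies in some bag.
  This serves the case \<open>k = 0\<close>.\<close>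

lemma no_vertices_of_treewidth_neg:
  assumes G: "pair_graph G" and tw: "treewidth G + 1 \<le> 0"
  shows "pverts G = {}"
proof -
  obtain T :: "nat pair_pre_digraph" and B
    where td: "tree_decomposition G T B" and w: "decomp_width T B = treewidth G"
    using treewidth_attained tree_decomposition_single_bag[OF G] by blast
  interpret G: pair_graph G by fact
  have "undirected_tree T" using td by (simp add: tree_decomposition_def)
  then interpret T: pair_graph T by (simp add: undirected_tree_def)
  have "B x = {}" if x: "x \<in> pverts T" for x
  proof -
    have "card (B x) \<le> Max ((\<lambda>x. card (B x)) ` pverts T)"
      using x T.pair_finite_verts by (intro Max_ge) auto
    then have "card (B x) = 0" using w tw by (simp add: decomp_width_def)
    moreover have "B x \<subseteq> pverts G" using td x by (simp add: tree_decomposition_def)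
    then have "finite (B x)" using G.pair_finite_verts by (rule finite_subset)
    ultimately show ?thesis by simp
  qed
  moreover have "bag_nodes T B v \<noteq> {}" if "v \<in> pverts G" for v
    using td that by (auto simp: tree_decomposition_def connected_conv)
  ultimately show ?thesis by (auto simp: bag_nodes_def)
qed

theorem theorem6:
  fixes G :: "'a pair_pre_digraph" and k :: int
  assumes "pair_graph G"
    and "k \<ge> treewidth G + 1"
  shows "\<exists>(T :: nat pair_pre_digraph) B.
    tree_decomposition G T B \<and>
    decomp_width T B \<le> 72 * k + 1 \<and>
    decomp_degree T \<le> 12 \<and>
    real (decomp_order T) \<le> max (real (card (pverts G)) / (2 * real_of_int k)) 1 \<and>
    (\<forall>v \<in> pverts G. spread T B v \<le> 1 + out_degree G v)"
proof -
  interpret pair_graph G by fact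
  have "0 \<le> treewidth G + 1"
    using treewidth_attained tree_decomposition_single_bag[OF assms(1)]
    by (metis add.commute decomp_width_def diff_add_cancel of_nat_0_le_iff)
  then have k0: "0 \<le> k" using assms(2) by linarith
  define m where "m = nat k"
  have m: "k = int m" using k0 by (simp add: m_def)
  show ?thesis
  \<comment> \<open>With fewer than \<open>4 * m\<close> vertices, or with \<open>m = 0\<close> and
    hence no vertices, one bag is enough, and the order is bounded by the 1 in the maximum.\<close>
  proof (cases "4 * m \<le> card (pverts G) \<and> 1 \<le> m")
    case False
    then have "int (card (pverts G)) \<le> 72 * k"
      using no_vertices_of_treewidth_neg[OF assms(1)] assms(2) m by (cases "m = 0") auto
    moreover obtain T :: "nat pair_pre_digraph" and B where "tree_decomposition G T B"
      "decomp_width T B \<le> int (card (pverts G)) - 1" "decomp_degree T \<le> 1"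
      "decomp_order T = 1" "\<forall>v. spread T B v \<le> 1"
      using tree_decomposition_single_bag[OF assms(1)] by blast
    ultimately show ?thesis
      by (intro exI[of _ T] exI[of _ B]) (auto intro: order_trans trans_le_add1)
  next
    case True
    \<comment> \<open>Any set of the least admissible size \<open>4 * m\<close> can start the
      recursion.\<close>
    then obtain S where S: "S \<subseteq> pverts G" "card S = 4 * m"
      using obtain_subset_with_card_n by blast
    have "separable m (pverts G) (parcs G)"
      using separable_of_treewidth[OF assms(1)] assms(2) True m by simp
    moreover have "sym (parcs G)" by (auto intro: symI arcs_symmetric)
    moreover have "parcs G \<subseteq> parcs G \<inter> pverts G \<times> pverts G" by (auto dest: in_arcsD1 in_arcsD2)
    ultimately obtain B ts where d: "rooted_decomposition m (pverts G) (parcs G) S B ts"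
      using rooted_decomposition_exists[OF _ _ pair_finite_verts order_refl] S True
      by (metis le_numeral_extra(4) mult_le_mono1 order_refl numeral_le_iff semiring_norm(68,71))
    let ?t = "Node B ts"
    have "\<exists>(T :: nat pair_pre_digraph) B. tree_decomposition G T B \<and>
      decomp_width T B \<le> int (72 * m) - 1 \<and> decomp_degree T \<le> Suc 11 \<and> decomp_order T = nodes ?t \<and>
      (\<forall>v. spread T B v = occurrences v ?t)"
      using d rooted_decomposition_bounded[OF d] S True
      by (intro tree_decomposition_of_bag_tree[OF assms(1)])
        (simp_all add: rooted_decomposition_def del: support.simps coherent.simps covers.simps)
    then obtain T :: "nat pair_pre_digraph" and B' where T: "tree_decomposition G T B'"
      "decomp_width T B' \<le> int (72 * m) - 1" "decomp_degree T \<le> Suc 11" "decomp_order T = nodes ?t"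
      "\<And>v. spread T B' v = occurrences v ?t"
      by blast
    have "card (pverts G - S) = card (pverts G) - 4 * m"
      using S pair_finite_verts finite_subset by (metis card_Diff_subset)
    moreover have "2 * m * nodes ?t \<le> 2 * m + card (pverts G - S)"
      using d by (simp add: rooted_decomposition_def del: nodes.simps)
    \<comment> \<open>The \<open>4 * m\<close> vertices of \<open>S\<close> outweigh the additive
      \<open>2 * m\<close> of the invariant.\<close>
    ultimately have "2 * m * nodes ?t \<le> card (pverts G)" using True by linarith
    then have "2 * real m * real (nodes ?t) \<le> real (card (pverts G))"
      by (metis of_nat_le_iff of_nat_mult of_nat_numeral)
    then have "real (nodes ?t) \<le> real (card (pverts G)) / (2 * real_of_int k)"
      using True m by (simp add: field_simps del: nodes.simps)
    moreover have "occurrences v ?t \<le> 1 + out_degree G v" if v: "v \<in> pverts G" for v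
    proof -
      have "out_arcs G v = Pair v ` (parcs G `` {v})" by (auto simp: out_arcs_def)
      then have "out_degree G v = card (parcs G `` {v})"
        by (simp add: out_degree_def card_image inj_on_def)
      then show ?thesis using d v by (simp add: rooted_decomposition_def del: occurrences.simps)
    qed
    ultimately show ?thesis
      using T m by (intro exI[of _ T] exI[of _ B']) (simp del: nodes.simps occurrences.simps)
  qed
qed

end
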